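(* Let $q\in L_2(0,\pi)$ be real valued, let $\mu_1^2$ be the smallest eigenvalue of the Dirichlet problem $-y''+q(x)y=\lambda y$, $y(0)=y(\pi)=0$, and set $\widetilde q(x):=q(x)-\mu_1^2$. Let $\widetilde S(\rho,x)$ be the solution of $-y''+\widetilde q(x)y=\rho^2y$ on $(0,\pi)$ with $\widetilde S(\rho,0)=0$, $\widetilde S'(\rho,0)=1$, and let $\widetilde s_n(\pi)$, $n\ge 0$, be the coefficients of its Neumann series of Bessel functions representation at $x=\pi$ (see context). For $N\in\mathbb N$ put $$\widetilde S_N(\rho,\pi)=\frac{\sin(\rho\pi)}{\rho}+\frac1\rho\sum_{n=0}^{N}(-1)^n\widetilde s_n(\pi)\,\mathbf j_{2n+1}(\rho\pi).$$ Then for every $\varepsilon>0$ there exists $N\in\mathbb N$ such that every zero of the function $\rho\mapsto\widetilde S(\rho,\pi)$ is approximated by a corresponding zero of $\rho\mapsto\widetilde S_N(\rho,\pi)$ with error at most $\varepsilon$ (uniformly over all zeros), and $\widetilde S_N(\rho,\pi)$ has no other zeros.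
   Context: $\mathbf j_k$ denotes the spherical Bessel function of the first kind of order $k$ (e.g. $\mathbf j_0(z)=\sin z/z$, $\mathbf j_1(z)=\sin z/z^2-\cos z/z$). It is known (Kravchenko–Navarro–Torba) that for real $q\in L_2(0,\pi)$ the solution $S(\rho,x)$ of $-y''+q(x)y=\rho^2y$ with $S(\rho,0)=0$, $S'(\rho,0)=1$ admits the representation $S(\rho,x)=\frac{\sin(\rho x)}{\rho}+\frac1\rho\sum_{n=0}^\infty(-1)^ns_n(x)\mathbf j_{2n+1}(\rho x)$ (the Neumann series of Bessel functions, NSBF), with coefficients $s_n(x)$ independent of $\rho$ (obtained from the Fourier–Legendre expansion of the transmutation kernel, $s_0(x)=3(S(0,x)/x-1)$), the series converging pointwise for every $\rho\in\mathbb C$, uniformly on compact subsets of the $\rho$-plane for every fixed $x$, and with the remainder after $N$ terms bounded by a quantity $\varepsilon_N(x)\to0$ ($N\to\infty$) independent of $\rho\in\mathbb R$. The coefficients $\widetilde s_n$ are the coefficients of this representation for the potential $\widetilde q$. *)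

theory Defs
  imports "HOL-Analysis.Analysis" "HOL-Complex_Analysis.Complex_Analysis"
begin

(* Spherical Bessel function of the first kind, via its (entire) power series
   j_k(z) = z^k * sum_m (-1)^m z^(2m) / (2^m m! (2k+2m+1)!!),
   with (2k+2m+1)!! = (2k+2m+1)! / (2^(k+m) (k+m)!). *)
definition sph_bessel_j :: "nat \<Rightarrow> complex \<Rightarrow> complex" where
  "sph_bessel_j k z = (\<Sum>m. (-1)^m * 2^k * of_nat (fact (k+m))
       / (of_nat (fact m) * of_nat (fact (2*k+2*m+1))) * z^(k+2*m))"

fun legendreP :: "nat \<Rightarrow> real \<Rightarrow> real" where
  "legendreP 0 x = 1"
| "legendreP (Suc 0) x = x"
| "legendreP (Suc (Suc n)) x =
     ((2 * real n + 3) * x * legendreP (Suc n) x - (real n + 1) * legendreP n x) / (real n + 2)"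

(* y is a (Caratheodory) solution on [0,pi] of  -y'' + q y = lam y  with
   y(0) = a, y'(0) = b: y is differentiable on [0,pi] with derivative y',
   and y' is absolutely continuous with y'' = (q - lam) y a.e., written in
   integrated form. *)
definition ivp_sol :: "(real \<Rightarrow> real) \<Rightarrow> complex \<Rightarrow> complex \<Rightarrow> complex \<Rightarrow> (real \<Rightarrow> complex) \<Rightarrow> bool" where
  "ivp_sol q lam a b y \<longleftrightarrow> y 0 = a \<and>
     (\<exists>y'. y' 0 = b \<and> (\<forall>x\<in>{0..pi}.
        (y has_vector_derivative y' x) (at x within {0..pi}) \<and>
        (\<lambda>t. (complex_of_real (q t) - lam) * y t) integrable_on {0..x} \<and>
        y' x = b + integral {0..x} (\<lambda>t. (complex_of_real (q t) - lam) * y t)))"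

definition dirichlet_eigenvalue :: "(real \<Rightarrow> real) \<Rightarrow> real \<Rightarrow> bool" where
  "dirichlet_eigenvalue q lam \<longleftrightarrow>
     (\<exists>y b. ivp_sol q (complex_of_real lam) 0 b y \<and> y pi = 0 \<and> (\<exists>x\<in>{0..pi}. y x \<noteq> 0))"

(* truncated NSBF S_N(rho, pi); the value at rho = 0 is the removable-singularity limit *)
definition S_trunc :: "(nat \<Rightarrow> real) \<Rightarrow> nat \<Rightarrow> complex \<Rightarrow> complex" where
  "S_trunc s N \<rho> = (if \<rho> = 0 then of_real (pi + pi * s 0 / 3)
     else sin (\<rho> * pi) / \<rho> + (1 / \<rho>) * (\<Sum>n\<le>N. (-1)^n * of_real (s n) * sph_bessel_j (2*n+1) (\<rho> * pi)))"

definition zeros_mult :: "(complex \<Rightarrow> complex) \<Rightarrow> (complex \<times> nat) set" where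
  "zeros_mult f = {(z, k). f z = 0 \<and> k < nat (zorder f z)}"

end

theory Submission
  imports Defs
begin

text \<open>
  Rescaled to the unit interval, the characteristic function is \<open>(sin (\<pi>\<rho>) + \<integral> k(u) sin (\<pi>\<rho>u) du) / \<rho>\<close>
  with \<open>k(u) = \<pi> K(\<pi>u)\<close>, and its truncated Bessel series is the same expression with \<open>k\<close>
  replaced by a partial sum of its expansion in odd Legendre polynomials, because
  \<open>\<integral> P\<^sub>2\<^sub>n\<^sub>+\<^sub>1(u) sin (zu) du = (-1)\<^sup>n j\<^sub>2\<^sub>n\<^sub>+\<^sub>1(z)\<close>. These partial sums converge to \<open>k\<close> in mean.
  The zeros depend stably on \<open>k\<close> in the mean norm: away from small discs about the large integers and about the
  finitely many remaining zeros, the characteristic function dominates \<open>exp (\<pi>\<bar>Im \<rho>\<bar>) / \<rho>\<close> (Riemann--Lebesgue),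
  whereas the perturbation is at most \<open>\<delta> exp (\<pi>\<bar>Im \<rho>\<bar>) / \<rho>\<close>, so Rouche's theorem applies on every disc.
  At \<open>\<rho> = 0\<close> the integral representation is recovered from continuous dependence of the solution on \<open>\<rho>\<close>.
\<close>

section \<open>Odd Legendre expansions\<close>

text \<open>The sine kernel is odd, so everything happens on the half interval [0,1]. Legendre
  polynomials of one parity remain orthogonal there, with squared norm 1/(2k+1); for k = 2n+1 this
  is the origin of the factor 4n+3 in the coefficients. The mean norm is the natural one, since it
  controls the change of the characteristic function in every complex direction by the same
  exponential that governs the growth of the sine; an estimate on the real line alone says nothing
  about the circles used for Rouche's theorem. As one \<epsilon> must serve infinitely many zeros,
  the lower bound and the perturbation must both keep their factor 1/|\<rho>|, otherwise their
  quotient degenerates at distant zeros. Rouche's theorem only compares numbers of zeros, counted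
  with multiplicity, in each disc. The pairs in \<open>zeros_mult\<close> turn equal finite counts
  into bijections, and pairwise disjoint discs let these be glued into one bijection.\<close>

lemma continuous_on_legendreP [continuous_intros]:
  fixes f :: "'a::topological_space \<Rightarrow> real"
  assumes "continuous_on S f"
  shows "continuous_on S (\<lambda>x. legendreP n (f x))"
  using assms by (induction n rule: induct_nat_012) (auto intro!: continuous_intros)

declare legendreP.simps(3) [simp del]

text \<open>The three-term recurrence under the integral sign. The weight \<open>f\<close> stays
  arbitrary because powers, Legendre polynomials and products of the two are all inserted for
  it.\<close>

lemma integral_legendreP_recurrence:
  assumes "continuous_on {0..1} f"
  shows "(real k + 2) * integral {0..1} (\<lambda>u. f u * legendreP (k + 2) u)
     = (2 * real k + 3) * integral {0..1} (\<lambda>u. f u * u * legendreP (Suc k) u)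
      - (real k + 1) * integral {0..1} (\<lambda>u. f u * legendreP k u)"
proof -
  have "(real k + 2) * integral {0..1} (\<lambda>u. f u * legendreP (k + 2) u)
     = integral {0..1} (\<lambda>u. (2 * real k + 3) * (f u * u * legendreP (Suc k) u) - (real k + 1) * (f u * legendreP k u))"
    by (subst integral_mult_right[symmetric], rule integral_cong) (simp add: field_simps legendreP.simps(3))
  also have "\<dots> = integral {0..1} (\<lambda>u. (2 * real k + 3) * (f u * u * legendreP (Suc k) u))
      - integral {0..1} (\<lambda>u. (real k + 1) * (f u * legendreP k u))"
    by (intro integral_diff integrable_continuous_interval continuous_intros assms)
  finally show ?thesis by simp
qed

text \<open>Closed form of the integral of u^(k+2i) P_k(u) over [0,1], that is, half of the
  classical moment over [-1,1]. Divided by (k+2i)! it is, up to the sign (-1)^i, the i-th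
  coefficient in the power series of \<open>sph_bessel_j k\<close>.\<close>

definition legendre_moment :: "nat \<Rightarrow> nat \<Rightarrow> real" where
  "legendre_moment k i = 2 ^ k * fact (k + 2 * i) * fact (k + i) / (fact i * fact (2 * k + 2 * i + 1))"

text \<open>This is the recurrence integrated against u^(k+2+2i): the extra factor u gives the
  exponent (k+1)+2(i+1), and the last term has exponent k+2(i+1). Once all factorials are reduced to
  four common ones, a polynomial identity remains.\<close>

lemma legendre_moment_step:
  "(real k + 2) * legendre_moment (k + 2) i
    = (2 * real k + 3) * legendre_moment (Suc k) (Suc i) - (real k + 1) * legendre_moment k (Suc i)"
proof -
  define x y z w :: real where "x = fact (k + 2 * i + 2)" and "y = fact (k + i + 1)"
    and "z = fact i" and "w = fact (2 * k + 2 * i + 3)"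
  have e1: "fact (k + 2 + 2 * i) = x" "fact (k + 2 * Suc i) = x" "fact (Suc k + 2 * Suc i) = (real k + 2 * real i + 3) * x"
    unfolding x_def by (auto simp: fact_reduce add_ac numeral_eq_Suc algebra_simps)
  have e2: "fact (k + 2 + i) = (real k + real i + 2) * y" "fact (Suc k + Suc i) = (real k + real i + 2) * y" "fact (k + Suc i) = y"
    unfolding y_def by (auto simp: fact_reduce add_ac numeral_eq_Suc algebra_simps)
  have e3: "fact (2 * (k + 2) + 2 * i + 1) = (2 * real k + 2 * real i + 5) * (2 * real k + 2 * real i + 4) * w"
     "fact (2 * Suc k + 2 * Suc i + 1) = (2 * real k + 2 * real i + 5) * (2 * real k + 2 * real i + 4) * w"
     "fact (2 * k + 2 * Suc i + 1) = w"
    unfolding w_def by (auto simp: fact_reduce add_ac numeral_eq_Suc algebra_simps)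
  have e4: "fact (Suc i) = (real i + 1) * z" by (simp add: z_def algebra_simps)
  have nz: "x > 0" "y > 0" "z > 0" "w > 0" unfolding x_def y_def z_def w_def by auto
  have pos: "real i + 1 > 0" "2 * real k + 2 * real i + 5 > 0" "2 * real k + 2 * real i + 4 > 0" by auto
  show ?thesis unfolding legendre_moment_def e1 e2 e3 e4 z_def[symmetric]
    using nz pos by (simp add: divide_simps) (simp add: algebra_simps)
qed

text \<open>The degenerate case i = -1 of the preceding identity, with vanishing left-hand side. It
  makes P_(k+2) orthogonal to u^k, the highest of the lower powers of the same parity.\<close>

lemma legendre_moment_diag:
  "(2 * real k + 3) * legendre_moment (Suc k) 0 = (real k + 1) * legendre_moment k 0"
proof -
  define y w :: real where "y = fact k" and "w = fact (2 * k + 1)"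
  have e: "fact (Suc k) = (real k + 1) * y" "fact (2 * Suc k + 1) = (2 * real k + 3) * (2 * real k + 2) * w"
    unfolding y_def w_def by (auto simp: fact_reduce add_ac numeral_eq_Suc algebra_simps)
  have nz: "y > 0" "w > 0" unfolding y_def w_def by auto
  have pos: "2 * real k + 3 > 0" "2 * real k + 2 > 0" by auto
  show ?thesis unfolding legendre_moment_def add_0_right mult_0_right e y_def[symmetric] w_def[symmetric]
    using nz pos by (simp add: divide_simps)
qed

lemma integral_power_01: "integral {0..1} (\<lambda>u::real. u ^ n) = 1 / (real n + 1)"
proof -
  have "((\<lambda>u::real. u ^ n) has_integral (1 ^ (n + 1) / (real n + 1) - 0 ^ (n + 1) / (real n + 1))) {0..1}"
  proof (rule fundamental_theorem_of_calculus)
    fix u :: real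
    have "((\<lambda>u. u ^ (n + 1) / (real n + 1)) has_real_derivative (real (n + 1) * u ^ n) / (real n + 1)) (at u within {0..1})"
      using DERIV_power[OF DERIV_ident, of "n + 1" u "{0..1}"] by (intro DERIV_cdivide) (simp add: mult_ac)
    then show "((\<lambda>u. u ^ (n + 1) / (real n + 1)) has_vector_derivative u ^ n) (at u within {0..1})"
      by (simp add: has_real_derivative_iff_has_vector_derivative add.commute add_nonneg_eq_0_iff)
  qed simp
  then show ?thesis by (simp add: integral_unique)
qed

lemma integral_power_legendreP:
  "integral {0..1} (\<lambda>u. u ^ (k + 2 * i) * legendreP k u) = legendre_moment k i"
proof (induction k arbitrary: i rule: induct_nat_012)
  case 0
  show ?case by (simp add: legendre_moment_def integral_power_01)
next
  case 1
  have "(\<lambda>u::real. u ^ (1 + 2 * i) * u) = (\<lambda>u. u ^ (2 * i + 2))" by (auto simp: power2_eq_square)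
  moreover have "legendre_moment 1 i = 1 / (real (2 * i + 2) + 1)"
  proof -
    define y w :: real where "y = fact i" and "w = fact (2 * i + 1)"
    have "fact (1 + 2 * i) = w" "fact (1 + i) = (real i + 1) * y"
      "fact (2 * 1 + 2 * i + 1) = (2 * real i + 3) * (2 * real i + 2) * w"
      unfolding y_def w_def by (auto simp: numeral_eq_Suc algebra_simps)
    moreover have "y > 0" "w > 0" unfolding y_def w_def by auto
    moreover have "2 * real i + 3 > 0" "2 * real i + 2 > 0" by auto
    ultimately show ?thesis unfolding legendre_moment_def y_def[symmetric]
      by (simp add: divide_simps)
  qed
  ultimately show ?case by (simp add: integral_power_01 del: power_Suc)
next
  case (ge2 k)
  have rec: "(real k + 2) * integral {0..1} (\<lambda>u. u ^ (k + 2 + 2 * i) * legendreP (k + 2) u)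
    = (2 * real k + 3) * integral {0..1} (\<lambda>u. u ^ (k + 2 + 2 * i) * u * legendreP (Suc k) u)
      - (real k + 1) * integral {0..1} (\<lambda>u. u ^ (k + 2 + 2 * i) * legendreP k u)"
    by (intro integral_legendreP_recurrence continuous_intros)
  have shift: "(\<lambda>u. u ^ (k + 2 + 2 * i) * u * legendreP (Suc k) u) = (\<lambda>u. u ^ (Suc k + 2 * Suc i) * legendreP (Suc k) u)"
    by (simp add: mult_ac fun_eq_iff)
  have base: "integral {0..1} (\<lambda>u. u ^ (k + 2 + 2 * i) * legendreP k u) = legendre_moment k (Suc i)"
    using ge2(1)[of "Suc i"] by simp
  have "(real k + 2) * integral {0..1} (\<lambda>u. u ^ (k + 2 + 2 * i) * legendreP (k + 2) u)
      = (real k + 2) * legendre_moment (k + 2) i"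
    unfolding rec shift base legendre_moment_step ge2(2) ..
  then have "integral {0..1} (\<lambda>u. u ^ (k + 2 + 2 * i) * legendreP (k + 2) u) = legendre_moment (k + 2) i"
    by (simp only: mult_cancel_left) (simp add: add_nonneg_eq_0_iff)
  then show ?case by simp
qed

text \<open>The parity condition makes the integrand even, so half-range orthogonality is inherited
  from the full range; for opposite parities it fails in general. In the induction the power two
  below the degree is handled by the moment identity, and for smaller powers both terms of the
  recurrence vanish.\<close>

lemma integral_low_power_legendreP:
  assumes "j < k" "even (j + k)"
  shows "integral {0..1} (\<lambda>u. u ^ j * legendreP k u) = 0"
  using assms
proof (induction k arbitrary: j rule: induct_nat_012)
  case (ge2 k)
  have *: "(real k + 2) * integral {0..1} (\<lambda>u. u ^ j * legendreP (k + 2) u)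
    = (2 * real k + 3) * integral {0..1} (\<lambda>u. u ^ j * u * legendreP (Suc k) u)
      - (real k + 1) * integral {0..1} (\<lambda>u. u ^ j * legendreP k u)"
    by (intro integral_legendreP_recurrence continuous_intros)
  have j1: "(\<lambda>u. u ^ j * u * legendreP (Suc k) u) = (\<lambda>u. u ^ Suc j * legendreP (Suc k) u)"
    by (auto simp: mult_ac)
  have "j \<noteq> Suc k" using ge2.prems by auto
  then consider "j = k" | "j < k" using ge2.prems by linarith
  then have "(2 * real k + 3) * integral {0..1} (\<lambda>u. u ^ j * u * legendreP (Suc k) u)
      - (real k + 1) * integral {0..1} (\<lambda>u. u ^ j * legendreP k u) = 0"
  proof cases
    case 1
    show ?thesis unfolding j1 1
      using integral_power_legendreP[of "Suc k" 0] integral_power_legendreP[of k 0] legendre_moment_diag[of k]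
      by (simp add: mult_ac)
  next
    case 2
    then show ?thesis unfolding j1 using ge2.IH(1)[of j] ge2.IH(2)[of "Suc j"] ge2.prems by simp
  qed
  with * have "(real k + 2) * integral {0..1} (\<lambda>u. u ^ j * legendreP (k + 2) u) = 0" by simp
  then show ?case by (simp add: add_nonneg_eq_0_iff)
qed auto

text \<open>The auxiliary power u^i makes the induction on j close: the recurrence trades P_(j+2)
  for u P_(j+1) and P_j, and neither term raises i+j or changes its parity.\<close>

lemma integral_power_legendreP_legendreP:
  assumes "i + j < k" "even (i + j + k)"
  shows "integral {0..1} (\<lambda>u. u ^ i * legendreP j u * legendreP k u) = 0"
  using assms
proof (induction j arbitrary: i rule: induct_nat_012)
  case 0
  then show ?case by (simp add: integral_low_power_legendreP)
next
  case 1
  have "(\<lambda>u. u ^ i * legendreP (Suc 0) u * legendreP k u) = (\<lambda>u. u ^ Suc i * legendreP k u)"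
    by (auto simp: mult_ac)
  then show ?case using 1 by (simp add: integral_low_power_legendreP del: power_Suc)
next
  case (ge2 j)
  have "(real j + 2) * integral {0..1} (\<lambda>u. (u ^ i * legendreP k u) * legendreP (j + 2) u)
     = (2 * real j + 3) * integral {0..1} (\<lambda>u. (u ^ i * legendreP k u) * u * legendreP (Suc j) u)
      - (real j + 1) * integral {0..1} (\<lambda>u. (u ^ i * legendreP k u) * legendreP j u)"
    by (intro integral_legendreP_recurrence continuous_intros)
  also have "\<dots> = 0" using ge2.IH(2)[of "Suc i"] ge2.IH(1)[of i] ge2.prems by (simp add: mult_ac)
  finally show ?case by (simp add: add_nonneg_eq_0_iff mult_ac)
qed

lemma legendreP_orthogonal:
  assumes "j \<noteq> k" "even (j + k)"
  shows "integral {0..1} (\<lambda>u. legendreP j u * legendreP k u) = 0"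
  using integral_power_legendreP_legendreP[of 0 j k] integral_power_legendreP_legendreP[of 0 k j] assms
  by (cases j k rule: linorder_cases) (auto simp: mult_ac add_ac)

text \<open>Two instances of the recurrence share the mixed integral of u P_(k+1) P_(k+2).
  Orthogonality removes their other terms, and eliminating the mixed integral leaves the ratio
  (2k+3)/(2k+5) between consecutive squared norms.\<close>

lemma legendreP_norm:
  "integral {0..1} (\<lambda>u. legendreP k u * legendreP k u) = 1 / (2 * real k + 1)"
proof (induction k rule: induct_nat_012)
  case 0
  show ?case by simp
next
  case 1
  show ?case using integral_power_01[of 2] by (simp add: power2_eq_square)
next
  case (ge2 k)
  let ?I = "\<lambda>j l. integral {0..1} (\<lambda>u. legendreP j u * legendreP l u)"
  let ?J = "integral {0..1} (\<lambda>u. u * legendreP (Suc k) u * legendreP (k + 2) u)"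
  have a: "(real k + 2) * ?I (k + 2) (k + 2) = (2 * real k + 3) * ?J - (real k + 1) * ?I k (k + 2)"
    using integral_legendreP_recurrence[of "legendreP (k + 2)" k]
    by (simp add: continuous_intros mult_ac)
  have b: "(real (Suc k) + 2) * ?I (k + 3) (Suc k) = (2 * real (Suc k) + 3) * ?J - (real (Suc k) + 1) * ?I (Suc k) (Suc k)"
    using integral_legendreP_recurrence[of "legendreP (Suc k)" "Suc k"]
    by (simp add: continuous_intros mult_ac numeral_eq_Suc)
  have "?I k (k + 2) = 0" "?I (k + 3) (Suc k) = 0" by (rule legendreP_orthogonal; simp)+
  with a b have a': "(real k + 2) * ?I (k + 2) (k + 2) = (2 * real k + 3) * ?J"
    and b': "(2 * real k + 5) * ?J = (real k + 2) * ?I (Suc k) (Suc k)" by (simp_all add: add_ac)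
  have "?J = (real k + 2) / ((2 * real k + 5) * (2 * real k + 3))"
    using b' unfolding ge2 by (simp add: divide_simps) (simp add: algebra_simps)
  define X where "X = ?I (k + 2) (k + 2)"
  have "(real k + 2) * X = (2 * real k + 3) * ((real k + 2) / ((2 * real k + 5) * (2 * real k + 3)))"
    using a' \<open>?J = _\<close> unfolding X_def by simp
  then have "X = 1 / (2 * real k + 5)" by (simp add: divide_simps)
  then show ?case unfolding X_def by (simp add: add_ac)
qed

section \<open>Spherical Bessel functions as sine integrals of Legendre polynomials\<close>

lemma sph_bessel_j_sums:
  "(\<lambda>m. (-1) ^ m * 2 ^ k * of_nat (fact (k + m))
       / (of_nat (fact m) * of_nat (fact (2 * k + 2 * m + 1))) * z ^ (k + 2 * m)) sums S
    \<Longrightarrow> sph_bessel_j k z = S"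
  unfolding sph_bessel_j_def by (simp add: sums_iff)

text \<open>The sine series is integrated term by term. Even powers have coefficient 0, odd powers
  below 2n+1 are orthogonal to the polynomial, and the remaining exponents 2n+1+2m yield exactly the
  moments that occur in the Bessel series.\<close>

lemma integral_legendreP_sin:
  fixes z :: complex
  shows "integral {0..1} (\<lambda>u. of_real (legendreP (2 * n + 1) u) * sin (z * of_real u))
     = (-1) ^ n * sph_bessel_j (2 * n + 1) z"
proof -
  let ?k = "2 * n + 1"
  let ?P = "legendreP ?k"
  define f where "f m u = (\<Sum>i<m. complex_of_real (?P u) * (sin_coeff i *\<^sub>R (z * of_real u) ^ i))" for m and u :: real
  have "compact (?P ` {0..1})" by (intro compact_continuous_image continuous_intros) auto
  then obtain B where B: "\<And>u. u \<in> {0..1} \<Longrightarrow> \<bar>?P u\<bar> \<le> B"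
    by (fastforce dest!: compact_imp_bounded simp: bounded_iff)
  have B0: "0 \<le> B" using B[of 0] by auto
  have sums: "(\<lambda>i. complex_of_real (?P u) * (sin_coeff i *\<^sub>R (z * of_real u) ^ i)) sums
      (complex_of_real (?P u) * sin (z * of_real u))" for u
    by (intro sums_mult sin_converges)
  have "uniform_limit {0..1} f (\<lambda>u. \<Sum>i. complex_of_real (?P u) * (sin_coeff i *\<^sub>R (z * of_real u) ^ i)) sequentially"
    unfolding f_def
  proof (rule Weierstrass_m_test)
    show "summable (\<lambda>i. B * (inverse (fact i) * norm z ^ i))"
      using summable_exp[of "norm z"] by (intro summable_mult) (simp add: field_simps)
    fix i and u :: real assume u: "u \<in> {0..1}"
    have "\<bar>sin_coeff i\<bar> \<le> inverse (fact i :: real)" by (simp add: sin_coeff_def divide_simps)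
    moreover have "norm (z * of_real u) ^ i \<le> norm z ^ i"
      using u by (intro power_mono) (auto simp: norm_mult intro: mult_left_le)
    ultimately show "norm (complex_of_real (?P u) * (sin_coeff i *\<^sub>R (z * of_real u) ^ i)) \<le> B * (inverse (fact i) * norm z ^ i)"
      unfolding norm_mult norm_scaleR norm_power using B[OF u] B0
      by (intro mult_mono) (auto simp: norm_power)
  qed
  also have "(\<lambda>u. \<Sum>i. complex_of_real (?P u) * (sin_coeff i *\<^sub>R (z * of_real u) ^ i))
      = (\<lambda>u. complex_of_real (?P u) * sin (z * of_real u))"
    using sums by (auto simp: sums_iff)
  finally have lim: "uniform_limit {0..1} f (\<lambda>u. complex_of_real (?P u) * sin (z * of_real u)) sequentially" .
  have cont: "continuous_on {0..1} (f m)" for m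
    unfolding f_def by (intro continuous_intros)
  obtain I J where I: "\<And>m. (f m has_integral I m) {0..1}"
     and J: "((\<lambda>u. complex_of_real (?P u) * sin (z * of_real u)) has_integral J) {0..1}" and lim: "I \<longlonglongrightarrow> J"
    using uniform_limit_integral[OF lim cont sequentially_bot] by blast
  define c where "c i = sin_coeff i *\<^sub>R z ^ i * of_real (integral {0..1} (\<lambda>u. u ^ i * ?P u))" for i
  have tm: "((\<lambda>u. complex_of_real (?P u) * (sin_coeff i *\<^sub>R (z * of_real u) ^ i)) has_integral c i) {0..1}" for i
  proof -
    have "((\<lambda>u. u ^ i * ?P u) has_integral integral {0..1} (\<lambda>u. u ^ i * ?P u)) {0..1}"
      by (intro integrable_integral integrable_continuous_interval continuous_intros)
    then have "((\<lambda>u. complex_of_real (u ^ i * ?P u)) has_integral of_real (integral {0..1} (\<lambda>u. u ^ i * ?P u))) {0..1}"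
      by (rule has_integral_of_real)
    from has_integral_mult_right[OF this, of "sin_coeff i *\<^sub>R z ^ i"] show ?thesis
      by (simp add: c_def power_mult_distrib mult_ac)
  qed
  have "I m = (\<Sum>i<m. c i)" for m
  proof (rule has_integral_unique[OF I])
    show "(f m has_integral (\<Sum>i<m. c i)) {0..1}"
      unfolding f_def by (intro has_integral_sum tm) simp
  qed
  then have "I = (\<lambda>m. \<Sum>i<m. c i)" by (rule ext)
  with lim have "c sums J" by (simp add: sums_def)
  moreover have "c i = 0" if "i \<notin> range (\<lambda>m. ?k + 2 * m)" for i
  proof (cases "even i")
    case True
    then show ?thesis by (simp add: c_def sin_coeff_def)
  next
    case False
    have "i < ?k"
    proof (rule ccontr)
      assume "\<not> i < ?k"
      with False have "i = ?k + 2 * ((i - ?k) div 2)" by simp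
      with that show False by blast
    qed
    then show ?thesis using integral_low_power_legendreP[of i ?k] False by (simp add: c_def)
  qed
  ultimately have "(\<lambda>m. c (?k + 2 * m)) sums J"
    using sums_mono_reindex[of "\<lambda>m. ?k + 2 * m" c J] by (simp add: strict_mono_def)
  moreover have "c (?k + 2 * m) = (-1) ^ n * ((-1) ^ m * 2 ^ ?k * of_nat (fact (?k + m))
       / (of_nat (fact m) * of_nat (fact (2 * ?k + 2 * m + 1))) * z ^ (?k + 2 * m))" for m
  proof -
    have sc: "sin_coeff (?k + 2 * m) = (-1) ^ n * (-1) ^ m / fact (?k + 2 * m)"
    proof -
      have "odd (?k + 2 * m)" "(?k + 2 * m - Suc 0) div 2 = n + m" by auto
      then show ?thesis unfolding sin_coeff_def power_add[symmetric] by simp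
    qed
    have "c (?k + 2 * m) = of_real (sin_coeff (?k + 2 * m) * legendre_moment ?k m) * z ^ (?k + 2 * m)"
      unfolding c_def integral_power_legendreP by (simp add: scaleR_conv_of_real mult_ac)
    also have "sin_coeff (?k + 2 * m) * legendre_moment ?k m
       = (-1) ^ n * ((-1) ^ m * 2 ^ ?k * fact (?k + m) / (fact m * fact (2 * ?k + 2 * m + 1)))"
      unfolding sc legendre_moment_def by (simp add: mult_ac del: fact_Suc)
    finally show ?thesis by (simp only: of_real_mult of_real_divide of_real_power of_real_minus of_real_1 of_real_fact of_nat_fact of_real_numeral mult.assoc)
  qed
  \<comment> \<open>The sine coefficient at exponent 2n+1+2m carries the sign (-1)^(n+m). A second
    factor (-1)^n cancels the part depending on n and leaves the Bessel series itself.\<close>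
  ultimately have "(\<lambda>m. (-1) ^ n * ((-1) ^ n * ((-1) ^ m * 2 ^ ?k * of_nat (fact (?k + m))
       / (of_nat (fact m) * of_nat (fact (2 * ?k + 2 * m + 1))) * z ^ (?k + 2 * m)))) sums ((-1) ^ n * J)"
    by (intro sums_mult) (simp only:)
  then have "sph_bessel_j ?k z = (-1) ^ n * J"
    by (intro sph_bessel_j_sums) (simp only: mult.assoc[symmetric] left_minus_one_mult_self minus_one_mult_self mult_1)
  then show ?thesis using J by (simp add: integral_unique)
qed

section \<open>Density of the odd Legendre polynomials and convergence in mean\<close>

inductive odd_legendre_span :: "(real \<Rightarrow> real) \<Rightarrow> bool" where
  base: "odd_legendre_span (legendreP (2 * n + 1))"
| add: "odd_legendre_span f \<Longrightarrow> odd_legendre_span g \<Longrightarrow> odd_legendre_span (\<lambda>x. f x + g x)"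
| scale: "odd_legendre_span f \<Longrightarrow> odd_legendre_span (\<lambda>x. c * f x)"

lemma legendreP_1: "legendreP (Suc 0) = (\<lambda>x. x)"
  by (rule ext) simp

lemma times_legendreP:
  "x * legendreP (Suc k) x = ((real k + 2) * legendreP (k + 2) x + (real k + 1) * legendreP k x) / (2 * real k + 3)"
  proof -
  have "(real k + 2) * legendreP (k + 2) x = (2 * real k + 3) * x * legendreP (Suc k) x - (real k + 1) * legendreP k x"
    by (simp add: legendreP.simps(3))
  then show ?thesis by (simp add: field_simps)
qed

text \<open>One multiplication by x leads from odd to even degrees, the second one back. By
  linearity only the generators need this computation.\<close>

lemma odd_legendre_span_power2:
  assumes "odd_legendre_span f"
  shows "odd_legendre_span (\<lambda>x. x\<^sup>2 * f x)"
  using assms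
proof induction
  case (base n)
  have up: "\<exists>a b. \<forall>x. x * legendreP (2 * n + 2) x = a * legendreP (2 * n + 3) x + b * legendreP (2 * n + 1) x"
    using times_legendreP[where k = "2 * n + 1"]
    by (intro exI[of _ "(2 * real n + 3) / (4 * real n + 5)"] exI[of _ "(2 * real n + 2) / (4 * real n + 5)"])
       (simp add: add_divide_distrib algebra_simps numeral_eq_Suc)
  then obtain a b where up: "\<And>x. x * legendreP (2 * n + 2) x = a * legendreP (2 * n + 3) x + b * legendreP (2 * n + 1) x"
    by blast
  have mid: "x * legendreP (2 * n + 1) x
      = ((2 * real n + 2) / (4 * real n + 3)) * legendreP (2 * n + 2) x + ((2 * real n + 1) / (4 * real n + 3)) * legendreP (2 * n) x" for x
    using times_legendreP[where k = "2 * n"] by (simp add: add_divide_distrib algebra_simps)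
  have span: "odd_legendre_span (\<lambda>x. a * legendreP (2 * n + 3) x + b * legendreP (2 * n + 1) x)"
    using odd_legendre_span.base[of "Suc n"] odd_legendre_span.base[of n]
    by (intro odd_legendre_span.add odd_legendre_span.scale) (auto simp: numeral_eq_Suc)
  \<comment> \<open>Degree 0 has no lower neighbour, so the recurrence for x P_k does not apply to
    it; x P_0 is P_1 itself.\<close>
  have low: "odd_legendre_span (\<lambda>x. x * legendreP (2 * n) x)"
  proof (cases n)
    case 0
    then show ?thesis using odd_legendre_span.base[of 0] by (simp add: legendreP_1)
  next
    case (Suc m)
    have lin: "(a * P + b * Q) / c = (a / c) * P + (b / c) * Q" for a b c P Q :: real
      by (simp add: add_divide_distrib)
    have eq: "(\<lambda>x. x * legendreP (2 * n) x) = (\<lambda>x. ((2 * real m + 3) / (4 * real m + 5)) * legendreP (2 * (Suc m) + 1) x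
       + ((2 * real m + 2) / (4 * real m + 5)) * legendreP (2 * m + 1) x)"
    proof
      fix x
      show "x * legendreP (2 * n) x = ((2 * real m + 3) / (4 * real m + 5)) * legendreP (2 * (Suc m) + 1) x
       + ((2 * real m + 2) / (4 * real m + 5)) * legendreP (2 * m + 1) x"
        using times_legendreP[of x "2 * m + 1"] unfolding Suc lin by (simp add: ac_simps)
    qed
    show ?thesis unfolding eq
      by (intro odd_legendre_span.add odd_legendre_span.scale odd_legendre_span.base)
  qed
  have "(\<lambda>x. x\<^sup>2 * legendreP (2 * n + 1) x)
    = (\<lambda>x. ((2 * real n + 2) / (4 * real n + 3)) * (a * legendreP (2 * n + 3) x + b * legendreP (2 * n + 1) x)
        + ((2 * real n + 1) / (4 * real n + 3)) * (x * legendreP (2 * n) x))"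
  proof
    fix x
    have "x\<^sup>2 * legendreP (2 * n + 1) x = x * (x * legendreP (2 * n + 1) x)" by (simp add: power2_eq_square)
    also have "\<dots> = ((2 * real n + 2) / (4 * real n + 3)) * (x * legendreP (2 * n + 2) x)
        + ((2 * real n + 1) / (4 * real n + 3)) * (x * legendreP (2 * n) x)"
      unfolding mid by (simp only: distrib_left mult_ac)
    finally show "x\<^sup>2 * legendreP (2 * n + 1) x
      = ((2 * real n + 2) / (4 * real n + 3)) * (a * legendreP (2 * n + 3) x + b * legendreP (2 * n + 1) x)
        + ((2 * real n + 1) / (4 * real n + 3)) * (x * legendreP (2 * n) x)" unfolding up .
  qed
  then show ?case by (simp only:) (intro odd_legendre_span.add odd_legendre_span.scale span low)
next
  case (add f g)
  then show ?case using odd_legendre_span.add[OF add.IH] by (simp add: distrib_left)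
next
  case (scale f c)
  then show ?case using odd_legendre_span.scale[OF scale.IH, of c] by (simp add: mult_ac)
qed

text \<open>With \<open>f\<close> the identity this puts every odd polynomial u r(u^2) into the
  span. Leaving \<open>f\<close> arbitrary lets a product of polynomials act one factor after the
  other.\<close>

lemma odd_legendre_span_polynomial:
  assumes "real_polynomial_function r" "odd_legendre_span f"
  shows "odd_legendre_span (\<lambda>x. r (x\<^sup>2) * f x)"
  using assms
proof (induction arbitrary: f)
  case (linear r)
  then obtain c where "r = (\<lambda>x. x * c)" by (auto simp: real_bounded_linear)
  then show ?case
    using odd_legendre_span.scale[OF odd_legendre_span_power2[OF linear(2)], of c] by (simp add: mult_ac)
next
  case (const c)
  then show ?case by (rule odd_legendre_span.scale)
next
  case (add r1 r2)
  then show ?case using odd_legendre_span.add[OF add.IH(1)[OF add.prems] add.IH(2)[OF add.prems]]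
    by (simp add: distrib_right)
next
  case (mult r1 r2)
  then show ?case using mult.IH(1)[OF mult.IH(2)[OF mult.prems]] by (simp add: mult_ac)
qed

lemma odd_legendre_span_continuous:
  "odd_legendre_span f \<Longrightarrow> continuous_on A f"
  by (induction rule: odd_legendre_span.induct) (auto intro!: continuous_intros)

text \<open>An element of the span involves finitely many generators, but the inductive predicate
  does not record which. The cutoff M stands in for the degree: orthogonality to the generators up
  to M suffices.\<close>

lemma odd_legendre_span_orthogonal:
  assumes "odd_legendre_span f"
  shows "\<exists>M. \<forall>E. continuous_on {0..1} E \<longrightarrow> (\<forall>n\<le>M. integral {0..1} (\<lambda>u. E u * legendreP (2 * n + 1) u) = 0)
            \<longrightarrow> integral {0..1} (\<lambda>u. E u * f u) = 0"
  using assms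
proof induction
  case (base n)
  then show ?case by blast
next
  case (add f g)
  then obtain M1 M2 where
      M1: "\<And>E. continuous_on {0..1} E \<Longrightarrow> (\<And>n. n \<le> M1 \<Longrightarrow> integral {0..1} (\<lambda>u. E u * legendreP (2 * n + 1) u) = 0) \<Longrightarrow> integral {0..1} (\<lambda>u. E u * f u) = 0"
    and M2: "\<And>E. continuous_on {0..1} E \<Longrightarrow> (\<And>n. n \<le> M2 \<Longrightarrow> integral {0..1} (\<lambda>u. E u * legendreP (2 * n + 1) u) = 0) \<Longrightarrow> integral {0..1} (\<lambda>u. E u * g u) = 0"
    by metis
  show ?case
  proof (intro exI[of _ "max M1 M2"] allI impI)
    fix E :: "real \<Rightarrow> real" assume E: "continuous_on {0..1} E" and 0: "\<forall>n\<le>max M1 M2. integral {0..1} (\<lambda>u. E u * legendreP (2 * n + 1) u) = 0"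
    have "integral {0..1} (\<lambda>u. E u * f u + E u * g u) = integral {0..1} (\<lambda>u. E u * f u) + integral {0..1} (\<lambda>u. E u * g u)"
      by (intro integral_add integrable_continuous_interval continuous_intros E
          odd_legendre_span_continuous[OF add.hyps(1)] odd_legendre_span_continuous[OF add.hyps(2)])
    also have "\<dots> = 0" using M1[OF E] M2[OF E] 0 by simp
    finally show "integral {0..1} (\<lambda>u. E u * (f u + g u)) = 0" by (simp add: distrib_left)
  qed
next
  case (scale f c)
  have "(\<lambda>u. E u * (c * f u)) = (\<lambda>u. c * (E u * f u))" for E :: "real \<Rightarrow> real" by (simp add: mult_ac)
  with scale show ?case by auto
qed

text \<open>Odd polynomials have the form u r(u^2), so Stone-Weierstrass is used in the variable v =
  u^2, on the function k(sqrt v)/(sqrt v + h). Multiplication by u then yields an approximation of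
  k(u) u/(u+h).\<close>

lemma odd_legendre_span_dense:
  assumes k: "continuous_on {0..1} k" and e: "e > 0"
  obtains p where "odd_legendre_span p" "integral {0..1} (\<lambda>u. (k u - p u)\<^sup>2) \<le> e"
proof -
  have "compact (k ` {0..1})" using k by (intro compact_continuous_image) auto
  then obtain B0 where "\<And>u. u \<in> {0..1} \<Longrightarrow> \<bar>k u\<bar> \<le> B0"
    by (fastforce dest!: compact_imp_bounded simp: bounded_iff)
  then obtain B where B: "\<And>u. u \<in> {0..1} \<Longrightarrow> \<bar>k u\<bar> \<le> B" "B > 0"
    by (metis gt_ex less_eq_real_def order.strict_trans1 linorder_le_cases order_trans zero_less_one max.cobounded1 max.cobounded2 max_less_iff_conj)
  \<comment> \<open>The factor \<open>u / (u + h)\<close> forces \<open>k\<close> to vanish at 0, as every odd polynomial does, at a cost of order \<open>h\<close> in mean square.\<close>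
  define h where "h = e / (4 * B\<^sup>2)"
  have h: "h > 0" "2 * B\<^sup>2 * h = e / 2" using e B(2) by (auto simp: h_def)
  define \<eta> where "\<eta> = sqrt (e / 4)"
  have \<eta>: "\<eta> > 0" "2 * \<eta>\<^sup>2 = e / 2" using e by (auto simp: \<eta>_def)
  have "sqrt ` {0..1} \<subseteq> {0..1}" by auto
  then have "continuous_on {0..1} (\<lambda>v. k (sqrt v) / (sqrt v + h))"
    using h by (intro continuous_intros continuous_on_compose2[OF k]) (auto simp: add_nonneg_eq_0_iff)
  then obtain r where r: "real_polynomial_function r" "\<And>v. v \<in> {0..1} \<Longrightarrow> \<bar>k (sqrt v) / (sqrt v + h) - r v\<bar> < \<eta>"
    using Stone_Weierstrass_real_polynomial_function[of "{0..1::real}" _ \<eta>] \<eta> by auto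
  define p where "p u = r (u\<^sup>2) * u" for u
  have p: "odd_legendre_span p"
    using odd_legendre_span_polynomial[OF r(1) odd_legendre_span.base[of 0]] by (simp add: p_def[abs_def] legendreP_1)
  have "(k u - p u)\<^sup>2 \<le> 2 * B\<^sup>2 * h\<^sup>2 / (u + h)\<^sup>2 + 2 * \<eta>\<^sup>2" if u: "u \<in> {0..1}" for u
  proof -
    have u2: "u\<^sup>2 \<in> {0..1}" "sqrt (u\<^sup>2) = u" using u by (auto simp: power_le_one)
    have "\<bar>k u / (u + h) * u - p u\<bar> = \<bar>k u / (u + h) - r (u\<^sup>2)\<bar> * u"
    proof -
      have "k u / (u + h) * u - p u = (k u / (u + h) - r (u\<^sup>2)) * u"
        unfolding p_def by (simp only: left_diff_distrib)
      then show ?thesis using u by (simp only: abs_mult) simp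
    qed
    also have "\<dots> \<le> \<eta> * 1"
      using r(2)[OF u2(1)] u \<eta> unfolding u2(2) by (intro mult_mono) auto
    finally have 1: "(k u / (u + h) * u - p u)\<^sup>2 \<le> \<eta>\<^sup>2" by (simp add: abs_le_square_iff[symmetric])
    have "k u - k u / (u + h) * u = k u * (h / (u + h))" using u h by (simp add: field_simps)
    then have "(k u - k u / (u + h) * u)\<^sup>2 = (k u)\<^sup>2 * (h / (u + h))\<^sup>2" by (simp only: power_mult_distrib)
    also have "\<dots> \<le> B\<^sup>2 * (h / (u + h))\<^sup>2"
      using B(1)[OF u] B(2) by (intro mult_right_mono) (auto simp: abs_le_square_iff[symmetric])
    finally have 2: "(k u - k u / (u + h) * u)\<^sup>2 \<le> B\<^sup>2 * (h / (u + h))\<^sup>2" .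
    have "(a + b)\<^sup>2 \<le> 2 * a\<^sup>2 + 2 * b\<^sup>2" for a b :: real
      using zero_le_power2[of "a - b"] by (simp add: power2_eq_square algebra_simps)
    from this[of "k u - k u / (u + h) * u" "k u / (u + h) * u - p u"]
    have "(k u - p u)\<^sup>2 \<le> 2 * (k u - k u / (u + h) * u)\<^sup>2 + 2 * (k u / (u + h) * u - p u)\<^sup>2" by simp
    with 1 2 show ?thesis by (simp add: power_divide)
  qed
  note bound = this
  \<comment> \<open>The integral of h^2/(u+h)^2 is h - h^2/(1+h), hence at most h. So the cutoff
    costs at most 2 B^2 h = e/2 and the polynomial approximation 2 \<eta>^2 = e/2.\<close>
  have "((\<lambda>u. 2 * B\<^sup>2 * h\<^sup>2 / (u + h)\<^sup>2 + 2 * \<eta>\<^sup>2) has_integral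
      ((- 2 * B\<^sup>2 * h\<^sup>2 / (1 + h) + 2 * \<eta>\<^sup>2 * 1) - (- 2 * B\<^sup>2 * h\<^sup>2 / (0 + h) + 2 * \<eta>\<^sup>2 * 0))) {0..1}"
  proof (rule fundamental_theorem_of_calculus)
    fix u :: real assume "u \<in> {0..1}"
    with h have "((\<lambda>u. - 2 * B\<^sup>2 * h\<^sup>2 / (u + h) + 2 * \<eta>\<^sup>2 * u) has_real_derivative 2 * B\<^sup>2 * h\<^sup>2 / (u + h)\<^sup>2 + 2 * \<eta>\<^sup>2)
        (at u within {0..1})"
      by (auto intro!: derivative_eq_intros simp: power2_eq_square)
    then show "((\<lambda>u. - 2 * B\<^sup>2 * h\<^sup>2 / (u + h) + 2 * \<eta>\<^sup>2 * u) has_vector_derivative 2 * B\<^sup>2 * h\<^sup>2 / (u + h)\<^sup>2 + 2 * \<eta>\<^sup>2)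
        (at u within {0..1})"
      by (simp add: has_real_derivative_iff_has_vector_derivative)
  qed simp
  moreover have "((\<lambda>u. (k u - p u)\<^sup>2) has_integral integral {0..1} (\<lambda>u. (k u - p u)\<^sup>2)) {0..1}"
    by (intro integrable_integral integrable_continuous_interval continuous_intros k odd_legendre_span_continuous[OF p])
  ultimately have "integral {0..1} (\<lambda>u. (k u - p u)\<^sup>2) \<le> (- 2 * B\<^sup>2 * h\<^sup>2 / (1 + h) + 2 * \<eta>\<^sup>2 * 1) - (- 2 * B\<^sup>2 * h\<^sup>2 / (0 + h) + 2 * \<eta>\<^sup>2 * 0)"
    by (intro has_integral_le[OF _ _ bound])
  also have "\<dots> = 2 * \<eta>\<^sup>2 + 2 * B\<^sup>2 * h - 2 * B\<^sup>2 * h\<^sup>2 / (1 + h)"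
    using h by (simp add: power2_eq_square)
  also have "\<dots> \<le> 2 * \<eta>\<^sup>2 + 2 * B\<^sup>2 * h" using h by simp
  also have "\<dots> = e" using h(2) \<eta>(2) by linarith
  finally show ?thesis using p that by blast
qed

text \<open>Best approximation by orthogonal projection: the error E is orthogonal to the partial
  sum and, if N is large enough for the approximant p, also to p. Hence its mean square does not
  exceed that of k - p. The step from mean square to mean uses pointwise inequalities in place of
  Cauchy-Schwarz.\<close>

lemma odd_legendre_partial_sums_L1:
  fixes k :: "real \<Rightarrow> real" and c :: "nat \<Rightarrow> real"
  assumes k: "continuous_on {0..1} k"
    and c: "\<And>n. c n = (4 * real n + 3) * integral {0..1} (\<lambda>u. k u * legendreP (2 * n + 1) u)"
    and e: "e > 0"
  shows "\<exists>N. integral {0..1} (\<lambda>u. \<bar>k u - (\<Sum>n\<le>N. c n * legendreP (2 * n + 1) u)\<bar>) \<le> e"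
proof -
  obtain p where p: "odd_legendre_span p" "integral {0..1} (\<lambda>u. (k u - p u)\<^sup>2) \<le> e\<^sup>2"
    using odd_legendre_span_dense[OF k, of "e\<^sup>2"] e by auto
  obtain N where N: "\<And>E. continuous_on {0..1} E \<Longrightarrow> (\<And>n. n \<le> N \<Longrightarrow> integral {0..1} (\<lambda>u. E u * legendreP (2 * n + 1) u) = 0)
            \<Longrightarrow> integral {0..1} (\<lambda>u. E u * p u) = 0"
    using odd_legendre_span_orthogonal[OF p(1)] by metis
  define g where "g u = (\<Sum>n\<le>N. c n * legendreP (2 * n + 1) u)" for u
  define E where "E u = k u - g u" for u
  have g: "continuous_on {0..1} g" unfolding g_def by (intro continuous_intros)
  have E: "continuous_on {0..1} E" unfolding E_def by (intro continuous_intros k g)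
  note pc = odd_legendre_span_continuous[OF p(1), of "{0..1}"]
  note int = integrable_continuous_interval continuous_intros k g E pc
  have orth: "integral {0..1} (\<lambda>u. E u * legendreP (2 * m + 1) u) = 0" if m: "m \<le> N" for m
  proof -
    have "integral {0..1} (\<lambda>u. g u * legendreP (2 * m + 1) u)
      = integral {0..1} (\<lambda>u. \<Sum>n\<le>N. c n * (legendreP (2 * n + 1) u * legendreP (2 * m + 1) u))"
      unfolding g_def by (simp only: sum_distrib_right mult.assoc)
    also have "\<dots> = (\<Sum>n\<le>N. integral {0..1} (\<lambda>u. c n * (legendreP (2 * n + 1) u * legendreP (2 * m + 1) u)))"
      by (intro integral_sum int) auto
    also have "\<dots> = (\<Sum>n\<le>N. if n = m then c m / (4 * real m + 3) else 0)"
      using legendreP_orthogonal[of "2 * _ + 1" "2 * m + 1"] legendreP_norm[of "2 * m + 1"] by (intro sum.cong) auto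
    also have "\<dots> = integral {0..1} (\<lambda>u. k u * legendreP (2 * m + 1) u)"
      using m by (simp add: c)
    finally have "integral {0..1} (\<lambda>u. k u * legendreP (2 * m + 1) u) - integral {0..1} (\<lambda>u. g u * legendreP (2 * m + 1) u) = 0"
      by simp
    also have "integral {0..1} (\<lambda>u. k u * legendreP (2 * m + 1) u) - integral {0..1} (\<lambda>u. g u * legendreP (2 * m + 1) u)
      = integral {0..1} (\<lambda>u. k u * legendreP (2 * m + 1) u - g u * legendreP (2 * m + 1) u)"
      by (intro integral_diff[symmetric] int)
    finally show ?thesis by (simp add: E_def left_diff_distrib)
  qed
  have Ep: "integral {0..1} (\<lambda>u. E u * p u) = 0" by (rule N[OF E orth])
  have Eg: "integral {0..1} (\<lambda>u. E u * g u) = 0"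
  proof -
    have "integral {0..1} (\<lambda>u. E u * g u) = integral {0..1} (\<lambda>u. \<Sum>n\<le>N. c n * (E u * legendreP (2 * n + 1) u))"
      unfolding g_def by (simp add: sum_distrib_left mult_ac)
    also have "\<dots> = (\<Sum>n\<le>N. integral {0..1} (\<lambda>u. c n * (E u * legendreP (2 * n + 1) u)))"
      by (intro integral_sum int) auto
    also have "\<dots> = 0" using orth by simp
    finally show ?thesis .
  qed
  have "integral {0..1} (\<lambda>u. (E u)\<^sup>2) = integral {0..1} (\<lambda>u. E u * (k u - p u) + E u * p u - E u * g u)"
    by (simp add: E_def power2_eq_square algebra_simps)
  also have "\<dots> = integral {0..1} (\<lambda>u. E u * (k u - p u) + E u * p u) - integral {0..1} (\<lambda>u. E u * g u)"
    by (intro integral_diff int)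
  also have "integral {0..1} (\<lambda>u. E u * (k u - p u) + E u * p u) = integral {0..1} (\<lambda>u. E u * (k u - p u)) + integral {0..1} (\<lambda>u. E u * p u)"
    by (intro integral_add int)
  finally have "integral {0..1} (\<lambda>u. (E u)\<^sup>2) = integral {0..1} (\<lambda>u. E u * (k u - p u))" using Ep Eg by simp
  also have "\<dots> \<le> integral {0..1} (\<lambda>u. (E u)\<^sup>2 / 2 + (k u - p u)\<^sup>2 / 2)"
  proof (rule integral_le)
    fix u
    show "E u * (k u - p u) \<le> (E u)\<^sup>2 / 2 + (k u - p u)\<^sup>2 / 2"
      using sum_squares_bound[of "E u" "k u - p u"] by simp
  qed (auto intro!: int)
  also have "\<dots> = integral {0..1} (\<lambda>u. (E u)\<^sup>2 / 2) + integral {0..1} (\<lambda>u. (k u - p u)\<^sup>2 / 2)"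
    by (intro integral_add int) auto
  finally have E2: "integral {0..1} (\<lambda>u. (E u)\<^sup>2) \<le> e\<^sup>2" using p(2) by simp
  \<comment> \<open>The weight e in 2 e |E| \<le> E^2 + e^2 balances both halves: with mean square
    at most e^2, each contributes e/2.\<close>
  have "integral {0..1} (\<lambda>u. \<bar>E u\<bar>) \<le> integral {0..1} (\<lambda>u. (E u)\<^sup>2 / (2 * e) + e / 2)"
  proof (rule integral_le)
    fix u
    have "2 * e * \<bar>E u\<bar> \<le> (E u)\<^sup>2 + e\<^sup>2"
      using zero_le_power2[of "\<bar>E u\<bar> - e"] by (simp add: power2_eq_square algebra_simps)
    then show "\<bar>E u\<bar> \<le> (E u)\<^sup>2 / (2 * e) + e / 2"
      using e by (simp add: field_simps power2_eq_square)
  qed (use e in \<open>auto intro!: int\<close>)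
  also have "\<dots> = integral {0..1} (\<lambda>u. (E u)\<^sup>2 / (2 * e)) + integral {0..1} (\<lambda>u::real. e / 2)"
    by (intro integral_add int) (use e in auto)
  also have "\<dots> \<le> e\<^sup>2 / (2 * e) + e / 2" using E2 e by (simp add: divide_right_mono)
  also have "\<dots> = e" using e by (simp add: power2_eq_square)
  finally show ?thesis unfolding E_def g_def by blast
qed

section \<open>Rouche's theorem on a family of discs\<close>

lemma zeros_mult_ball:
  "{p \<in> zeros_mult f. fst p \<in> ball c r} = Sigma {z \<in> ball c r. f z = 0} (\<lambda>z. {..<nat (zorder f z)})"
  by (auto simp: zeros_mult_def)

lemma finite_zeros_ball:
  assumes "f holomorphic_on UNIV" "f w \<noteq> 0"
  shows "finite {z \<in> ball c r. f z = 0}"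
proof (cases "\<exists>z. f z = 0")
  case True
  then have "\<not> f constant_on UNIV" using assms(2) by (metis UNIV_I constant_on_def)
  then have "finite {z \<in> cball c r. f z = 0}"
    using assms by (intro holomorphic_compact_finite_zeros[of f UNIV]) auto
  then show ?thesis by (rule rev_finite_subset) auto
qed auto

text \<open>Rewrites the count with multiplicity as the sum in Rouche's theorem. The larger open
  ball of radius r+1 contains the closed disc; its additional zeros have winding number 0, those
  inside have winding number 1.\<close>

lemma card_zeros_mult_ball:
  assumes f: "f holomorphic_on UNIV" "f w \<noteq> 0" and r: "r > 0" and nz: "\<And>z. z \<in> sphere c r \<Longrightarrow> f z \<noteq> 0"
  shows "finite {p \<in> zeros_mult f. fst p \<in> ball c r}"
    "of_nat (card {p \<in> zeros_mult f. fst p \<in> ball c r})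
        = (\<Sum>p\<in>{z \<in> ball c (r + 1). f z = 0}. winding_number (circlepath c r) p * of_int (zorder f p))"
proof -
  show "finite {p \<in> zeros_mult f. fst p \<in> ball c r}"
    unfolding zeros_mult_ball using finite_zeros_ball[OF f] by auto
  \<comment> \<open>Orders of an entire function that is not identically zero are nonnegative, so
    the conversion by \<open>nat\<close> in \<open>zeros_mult\<close> loses nothing.\<close>
  have ge: "zorder f z \<ge> 0" for z
  proof (rule zorder_ge_0)
    show "f analytic_on {z}" using f(1) by (simp add: analytic_on_holomorphic) blast
    have "\<forall>\<^sub>F u in at z. f u \<noteq> 0 \<and> u \<in> UNIV"
      by (rule non_zero_neighbour_alt[OF f(1), of z w]) (use f(2) in auto)
    then show "\<exists>\<^sub>F u in at z. f u \<noteq> 0" by (auto intro: eventually_frequently)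
  qed
  have "of_nat (card {p \<in> zeros_mult f. fst p \<in> ball c r}) = (\<Sum>p\<in>{z \<in> ball c r. f z = 0}. complex_of_nat (nat (zorder f p)))"
    unfolding zeros_mult_ball using finite_zeros_ball[OF f] by (subst card_SigmaI) auto
  also have "\<dots> = (\<Sum>p\<in>{z \<in> ball c r. f z = 0}. winding_number (circlepath c r) p * of_int (zorder f p))"
    using ge by (intro sum.cong) (auto simp: winding_number_circlepath dist_norm norm_minus_commute)
  also have "\<dots> = (\<Sum>p\<in>{z \<in> ball c (r + 1). f z = 0}. winding_number (circlepath c r) p * of_int (zorder f p))"
  proof (rule sum.mono_neutral_left)
    show "finite {z \<in> ball c (r + 1). f z = 0}" by (rule finite_zeros_ball[OF f])
    show "\<forall>p\<in>{z \<in> ball c (r + 1). f z = 0} - {z \<in> ball c r. f z = 0}. winding_number (circlepath c r) p * of_int (zorder f p) = 0"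
    proof
      fix p assume p: "p \<in> {z \<in> ball c (r + 1). f z = 0} - {z \<in> ball c r. f z = 0}"
      then have "p \<notin> cball c r" using nz[of p] by (auto simp: sphere_def)
      then have "winding_number (circlepath c r) p = 0"
        using r by (intro winding_number_zero_outside[of _ "cball c r"]) (auto simp: sphere_def)
      then show "winding_number (circlepath c r) p * of_int (zorder f p) = 0" by simp
    qed
  qed (use r in auto)
  finally show "of_nat (card {p \<in> zeros_mult f. fst p \<in> ball c r})
        = (\<Sum>p\<in>{z \<in> ball c (r + 1). f z = 0}. winding_number (circlepath c r) p * of_int (zorder f p))" .
qed

lemma Rouche_zeros_mult_card:
  assumes f: "f holomorphic_on UNIV" and g: "g holomorphic_on UNIV" and r: "r > 0"
    and less: "\<And>z. z \<in> sphere c r \<Longrightarrow> cmod (f z - g z) < cmod (f z)"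
  shows "finite {p \<in> zeros_mult f. fst p \<in> ball c r}" "finite {p \<in> zeros_mult g. fst p \<in> ball c r}"
    "card {p \<in> zeros_mult f. fst p \<in> ball c r} = card {p \<in> zeros_mult g. fst p \<in> ball c r}"
proof -
  have fnz: "f z \<noteq> 0" and gnz: "g z \<noteq> 0" if "z \<in> sphere c r" for z using less[OF that] by auto
  have w: "c + of_real r \<in> sphere c r" using r by (auto simp: dist_norm)
  show "finite {p \<in> zeros_mult f. fst p \<in> ball c r}" "finite {p \<in> zeros_mult g. fst p \<in> ball c r}"
    by (rule card_zeros_mult_ball(1)[OF f fnz[OF w] r fnz] card_zeros_mult_ball(1)[OF g gnz[OF w] r gnz]; assumption)+
  note F = card_zeros_mult_ball[OF f fnz[OF w] r fnz] and G = card_zeros_mult_ball[OF g gnz[OF w] r gnz]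
  have "(\<Sum>p\<in>{p \<in> ball c (r + 1). f p + (g p - f p) = 0}. winding_number (circlepath c r) p * zorder (\<lambda>p. f p + (g p - f p)) p)
     = (\<Sum>p\<in>{p \<in> ball c (r + 1). f p = 0}. winding_number (circlepath c r) p * zorder f p)"
  proof (rule Rouche_theorem)
    show "f holomorphic_on ball c (r + 1)" "(\<lambda>p. g p - f p) holomorphic_on ball c (r + 1)"
      using f g by (auto intro!: holomorphic_intros intro: holomorphic_on_subset)
    show "\<forall>z. z \<notin> ball c (r + 1) \<longrightarrow> winding_number (circlepath c r) z = 0"
      using r by (intro allI impI winding_number_zero_outside[of _ "cball c r"]) (auto simp: sphere_def)
    show "\<forall>z\<in>path_image (circlepath c r). cmod (g z - f z) < cmod (f z)"
      using less r by (simp add: norm_minus_commute)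
  qed (use r finite_zeros_ball[OF f fnz[OF w]] finite_zeros_ball[OF g gnz[OF w]] in auto)
  then have eq: "(\<Sum>p\<in>{p \<in> ball c (r + 1). g p = 0}. winding_number (circlepath c r) p * zorder g p)
     = (\<Sum>p\<in>{p \<in> ball c (r + 1). f p = 0}. winding_number (circlepath c r) p * zorder f p)" by simp
  have "complex_of_nat (card {p \<in> zeros_mult g. fst p \<in> ball c r}) = of_nat (card {p \<in> zeros_mult f. fst p \<in> ball c r})"
    by (rule trans[OF G(2) trans[OF eq F(2)[symmetric]]])
  then have "card {p \<in> zeros_mult g. fst p \<in> ball c r} = card {p \<in> zeros_mult f. fst p \<in> ball c r}"
    by (rule of_nat_eq_iff[THEN iffD1])
  then show "card {p \<in> zeros_mult f. fst p \<in> ball c r} = card {p \<in> zeros_mult g. fst p \<in> ball c r}" ..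
qed

text \<open>The strict inequality off the open discs excludes zeros of either function there. Since
  the closed discs are disjoint, every boundary circle lies off all open discs, so each disc holds
  equally many zeros of both functions. The family may be infinite, as the local bijections are
  glued over disjoint sets.\<close>

lemma Rouche_zeros_mult_bij:
  assumes f: "f holomorphic_on UNIV" and g: "g holomorphic_on UNIV"
    and rad: "\<And>c. c \<in> C \<Longrightarrow> rad c > 0"
    and disj: "\<And>c d. c \<in> C \<Longrightarrow> d \<in> C \<Longrightarrow> c \<noteq> d \<Longrightarrow> cball c (rad c) \<inter> cball d (rad d) = {}"
    and less: "\<And>z. (\<And>c. c \<in> C \<Longrightarrow> z \<notin> ball c (rad c)) \<Longrightarrow> cmod (f z - g z) < cmod (f z)"
  shows "\<exists>\<phi>. bij_betw \<phi> (zeros_mult f) (zeros_mult g) \<and>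
     (\<forall>p \<in> zeros_mult f. \<exists>c\<in>C. fst p \<in> ball c (rad c) \<and> fst (\<phi> p) \<in> ball c (rad c))"
proof -
  define A where "A h c = {p \<in> zeros_mult h. fst p \<in> ball c (rad c)}" for h c
  have Un: "zeros_mult h = (\<Union>c\<in>C. A h c)" if "\<And>z. h z = 0 \<Longrightarrow> \<exists>c\<in>C. z \<in> ball c (rad c)" for h
    using that by (fastforce simp: A_def zeros_mult_def)
  have Unf: "zeros_mult f = (\<Union>c\<in>C. A f c)" and Ung: "zeros_mult g = (\<Union>c\<in>C. A g c)"
    using less by (intro Un; force)+
  have disjA: "c = d" if "c \<in> C" "d \<in> C" "p \<in> A h c" "q \<in> A k d" "fst p = fst q" for c d p q h k
  proof (rule ccontr)
    assume "c \<noteq> d"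
    then have "cball c (rad c) \<inter> cball d (rad d) = {}" by (rule disj[OF that(1,2)])
    moreover have "fst p \<in> cball c (rad c)" "fst p \<in> cball d (rad d)" using that(3-5) by (auto simp: A_def)
    ultimately show False by blast
  qed
  have "\<exists>\<psi>. bij_betw \<psi> (A f c) (A g c)" if c: "c \<in> C" for c
  proof -
    have "cmod (f z - g z) < cmod (f z)" if z: "z \<in> sphere c (rad c)" for z
    proof (rule less)
      fix d assume "d \<in> C"
      show "z \<notin> ball d (rad d)"
      proof (cases "d = c")
        case False
        then show ?thesis using disj[OF c \<open>d \<in> C\<close>] z by (metis IntI ball_subset_cball empty_iff sphere_cball subsetD)
      qed (use z in auto)
    qed
    from Rouche_zeros_mult_card[OF f g rad[OF c] this] show ?thesis
      unfolding A_def by (intro finite_same_card_bij) auto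
  qed
  then obtain \<psi> where \<psi>: "\<And>c. c \<in> C \<Longrightarrow> bij_betw (\<psi> c) (A f c) (A g c)" by metis
  \<comment> \<open>By disjointness a zero of \<open>f\<close> determines its disc, which selects
    the local bijection to use.\<close>
  define \<phi> where "\<phi> p = \<psi> (THE c. c \<in> C \<and> p \<in> A f c) p" for p
  have \<phi>: "\<phi> p = \<psi> c p" if "c \<in> C" "p \<in> A f c" for c p
  proof -
    have "(THE c. c \<in> C \<and> p \<in> A f c) = c"
      using that disjA[OF _ that(1) _ that(2) refl] by (intro the_equality) blast+
    then show ?thesis by (simp add: \<phi>_def)
  qed
  have bij: "bij_betw \<phi> (A f c) (A g c)" if "c \<in> C" for c
    using \<psi>[OF that] \<phi>[OF that] by (simp cong: bij_betw_cong)
  have "bij_betw \<phi> (\<Union>c\<in>C. A f c) (\<Union>c\<in>C. A g c)"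
    by (intro bij_betw_UNION_disjoint bij) (use disjA in \<open>simp add: disjoint_family_on_def; blast\<close>)
  moreover have "\<exists>c\<in>C. fst p \<in> ball c (rad c) \<and> fst (\<phi> p) \<in> ball c (rad c)" if "p \<in> zeros_mult f" for p
  proof -
    from that obtain c where c: "c \<in> C" "p \<in> A f c" unfolding Unf by blast
    then have "\<phi> p \<in> A g c" using bij[OF c(1)] by (auto simp: bij_betw_def)
    with c show ?thesis by (auto simp: A_def)
  qed
  ultimately show ?thesis unfolding Unf[symmetric] Ung[symmetric] by blast
qed

section \<open>Sine transforms\<close>

lemma norm_sin_le_exp_Im: "cmod (sin z) \<le> exp \<bar>Im z\<bar>"
proof -
  have "cmod (sin z) \<le> (cmod (exp (\<i> * z)) + cmod (exp (- (\<i> * z)))) / 2"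
    unfolding sin_exp_eq by (simp add: norm_divide norm_mult order_trans[OF norm_triangle_ineq4] divide_right_mono)
  also have "\<dots> = (exp (- Im z) + exp (Im z)) / 2" by simp
  also have "\<dots> \<le> (exp \<bar>Im z\<bar> + exp \<bar>Im z\<bar>) / 2" by (intro divide_right_mono add_mono) auto
  finally show ?thesis by simp
qed

lemma norm_cos_le_exp_Im: "cmod (cos z) \<le> exp \<bar>Im z\<bar>"
proof -
  have "cmod (cos z) \<le> (cmod (exp (\<i> * z)) + cmod (exp (- (\<i> * z)))) / 2"
    unfolding cos_exp_eq by (simp add: norm_divide norm_mult order_trans[OF norm_triangle_ineq] divide_right_mono)
  also have "\<dots> = (exp (- Im z) + exp (Im z)) / 2" by simp
  also have "\<dots> \<le> (exp \<bar>Im z\<bar> + exp \<bar>Im z\<bar>) / 2" by (intro divide_right_mono add_mono) auto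
  finally show ?thesis by simp
qed

lemma norm_sin_le_norm_exp_Im: "cmod (sin z) \<le> cmod z * exp \<bar>Im z\<bar>"
proof -
  have "cmod (sin z - sin 0) \<le> exp \<bar>Im z\<bar> * cmod (z - 0)"
  proof (rule field_differentiable_bound)
    fix w assume "w \<in> closed_segment 0 z"
    then obtain t where t: "w = of_real t * z" "0 \<le> t" "t \<le> 1" by (auto simp: in_segment scaleR_conv_of_real)
    then have "\<bar>Im w\<bar> \<le> \<bar>Im z\<bar>" by (auto simp: abs_mult intro: mult_left_le_one_le)
    then show "cmod (cos w) \<le> exp \<bar>Im z\<bar>" using norm_cos_le_exp_Im[of w] by (meson exp_le_cancel_iff order_trans)
    show "(sin has_field_derivative cos w) (at w within closed_segment 0 z)"
      by (auto intro!: derivative_eq_intros)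
  qed auto
  then show ?thesis by (simp add: mult.commute)
qed

text \<open>By the reverse triangle inequality |sin z| is at least sinh |Im z|. For |Im z| \<ge> 1
  the decaying exponential is at most half of the growing one, which leaves the factor 1/4.\<close>

lemma norm_sin_ge_exp_Im:
  assumes "\<bar>Im z\<bar> \<ge> 1"
  shows "exp \<bar>Im z\<bar> / 4 \<le> cmod (sin z)"
proof -
  have e: "exp (- \<bar>Im z\<bar>) \<le> exp \<bar>Im z\<bar> / 2"
  proof -
    have "2 \<le> exp (2 * \<bar>Im z\<bar>)" using exp_ge_add_one_self[of "2 * \<bar>Im z\<bar>"] assms by linarith
    then have "exp (- \<bar>Im z\<bar>) * 2 \<le> exp (- \<bar>Im z\<bar>) * exp (2 * \<bar>Im z\<bar>)" by simp
    then show ?thesis by (simp flip: exp_add)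
  qed
  have "exp \<bar>Im z\<bar> - exp (- \<bar>Im z\<bar>) \<le> \<bar>exp (- Im z) - exp (Im z)\<bar>" by (auto simp: abs_if)
  also have "\<dots> = \<bar>cmod (exp (\<i> * z)) - cmod (exp (- (\<i> * z)))\<bar>" by simp
  also have "\<dots> \<le> cmod (exp (\<i> * z) - exp (- (\<i> * z)))" by (rule norm_triangle_ineq3)
  also have "\<dots> = 2 * cmod (sin z)" by (simp add: sin_exp_eq norm_divide norm_mult)
  finally show ?thesis using e by linarith
qed

lemma compact_nonzero_lower_bound:
  fixes f :: "'a::topological_space \<Rightarrow> 'b::real_normed_vector"
  assumes "compact Q" "continuous_on Q f" "\<And>x. x \<in> Q \<Longrightarrow> f x \<noteq> 0"
  obtains m where "m > 0" "\<And>x. x \<in> Q \<Longrightarrow> m \<le> norm (f x)"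
proof (cases "Q = {}")
  case True
  then show ?thesis using that[of 1] by simp
next
  case False
  have "continuous_on Q (\<lambda>x. norm (f x))" using assms(2) by (intro continuous_intros)
  with continuous_attains_inf[OF assms(1) False] obtain x where "x \<in> Q" "\<And>y. y \<in> Q \<Longrightarrow> norm (f x) \<le> norm (f y)"
    by blast
  then show ?thesis using assms(3) by (intro that[of "norm (f x)"]) auto
qed

lemma sin_pi_shift: "cmod (sin (of_real pi * (\<rho> - of_int n))) = cmod (sin (of_real pi * \<rho>))"
proof -
  have "sin (of_real pi * (\<rho> - of_int n)) = sin (of_real pi * \<rho>) * cos (of_real (pi * of_int n)) - cos (of_real pi * \<rho>) * sin (of_real (pi * of_int n))"
    by (simp add: right_diff_distrib sin_diff del: sin_of_real cos_of_real)
  also have "\<dots> = sin (of_real pi * \<rho>) * of_real (cos (pi * of_int n))"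
    unfolding sin_of_real cos_of_real by (simp add: mult.commute)
  finally show ?thesis by (simp add: norm_mult mult.commute)
qed

text \<open>For |Im \<rho>| \<ge> 1 exponential growth suffices. In the remaining strip the period 1
  of |sin(pi \<rho>)| reduces the claim to a compact rectangle around 0 with a disc about its only
  zero removed.\<close>

lemma sin_pi_lower_bound:
  assumes "r > 0"
  obtains c where "c > 0"
    "\<And>\<rho>. (\<And>n::int. cmod (\<rho> - of_int n) \<ge> r) \<Longrightarrow> c * exp (pi * \<bar>Im \<rho>\<bar>) \<le> cmod (sin (of_real pi * \<rho>))"
proof -
  define Q where "Q = cbox (Complex (-1/2) (-1)) (Complex (1/2) 1) - ball 0 r"
  have "compact Q" unfolding Q_def by (intro compact_diff) auto
  moreover have "continuous_on Q (\<lambda>\<rho>. sin (of_real pi * \<rho>))" by (intro continuous_intros)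
  moreover have "sin (of_real pi * \<rho>) \<noteq> 0" if "\<rho> \<in> Q" for \<rho>
  proof
    assume "sin (of_real pi * \<rho>) = 0"
    then obtain n :: int where n: "of_real pi * \<rho> = of_real (n * pi)" unfolding sin_eq_0 by blast
    then have "\<rho> = of_int n" by simp
    moreover have "\<bar>Re \<rho>\<bar> \<le> 1 / 2" "cmod \<rho> \<ge> r" using that by (auto simp: Q_def in_cbox_complex_iff)
    ultimately have "\<bar>real_of_int n\<bar> \<le> 1 / 2" "r \<le> \<bar>real_of_int n\<bar>" by (auto simp: norm_of_int)
    then have "n = 0" by linarith
    with \<open>r \<le> \<bar>real_of_int n\<bar>\<close> assms show False by simp
  qed
  ultimately obtain m where m: "m > 0" "\<And>\<rho>. \<rho> \<in> Q \<Longrightarrow> m \<le> cmod (sin (of_real pi * \<rho>))"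
    using compact_nonzero_lower_bound[of Q "\<lambda>\<rho>. sin (of_real pi * \<rho>)"] by blast
  \<comment> \<open>The value 1/4 serves the region |Im \<rho>| \<ge> 1; in the strip the
    exponential is at most exp(pi), whence m / exp(pi).\<close>
  define c where "c = min (1 / 4) (m / exp pi)"
  show ?thesis
  proof (rule that[of c])
    show "c > 0" using m by (simp add: c_def)
    fix \<rho> :: complex assume far: "\<And>n::int. cmod (\<rho> - of_int n) \<ge> r"
    show "c * exp (pi * \<bar>Im \<rho>\<bar>) \<le> cmod (sin (of_real pi * \<rho>))"
    proof (cases "\<bar>Im \<rho>\<bar> \<ge> 1")
      case True
      then have "1 * 1 \<le> pi * \<bar>Im \<rho>\<bar>" using pi_ge_two by (intro mult_mono) auto
      then have "exp (pi * \<bar>Im \<rho>\<bar>) / 4 \<le> cmod (sin (of_real pi * \<rho>))"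
        using norm_sin_ge_exp_Im[of "of_real pi * \<rho>"] by (simp add: abs_mult)
      moreover have "c * exp (pi * \<bar>Im \<rho>\<bar>) \<le> 1 / 4 * exp (pi * \<bar>Im \<rho>\<bar>)"
        unfolding c_def by (intro mult_right_mono min.cobounded1) auto
      ultimately show ?thesis by linarith
    next
      case False
      define n where "n = round (Re \<rho>)"
      have "\<bar>Re \<rho> - of_int n\<bar> \<le> 1 / 2" using of_int_round_abs_le[of "Re \<rho>"] by (simp add: n_def abs_minus_commute)
      then have "- (1 / 2) \<le> Re \<rho> - of_int n" "Re \<rho> - of_int n \<le> 1 / 2" by linarith+
      moreover have "- 1 \<le> Im \<rho>" "Im \<rho> \<le> 1" using False by linarith+
      ultimately have "\<rho> - of_int n \<in> Q" using far[of n] by (simp add: Q_def in_cbox_complex_iff)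
      from m(2)[OF this] have "m \<le> cmod (sin (of_real pi * \<rho>))" by (simp only: sin_pi_shift)
      moreover have "c * exp (pi * \<bar>Im \<rho>\<bar>) \<le> m / exp pi * exp pi"
        using False m unfolding c_def by (intro mult_mono min.cobounded2) auto
      ultimately show ?thesis by simp
    qed
  qed
qed

section \<open>Sine transforms and a Riemann-Lebesgue estimate in the complex plane\<close>

definition sine_transform :: "(real \<Rightarrow> real) \<Rightarrow> complex \<Rightarrow> complex" where
  "sine_transform k z = integral {0..1} (\<lambda>u. of_real (k u) * sin (z * of_real u))"

lemma sine_transform_integrable:
  fixes z :: complex
  assumes "continuous_on {0..1} k"
  shows "(\<lambda>u. of_real (k u) * sin (z * of_real u)) integrable_on {0..1}"
  by (intro integrable_continuous_interval continuous_intros assms)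

lemma sine_transform_deriv:
  assumes "continuous_on {0..1} k"
  shows "(sine_transform k has_field_derivative integral {0..1} (\<lambda>u. of_real (k u) * (of_real u * cos (z * of_real u)))) (at z)"
proof -
  have k2: "continuous_on (UNIV \<times> {0..1}) (\<lambda>p::complex \<times> real. k (snd p))"
    by (rule continuous_on_compose2[OF assms]) (auto intro!: continuous_intros)
  have "((\<lambda>z. integral (cbox 0 1) (\<lambda>u. of_real (k u) * sin (z * of_real u)))
      has_field_derivative integral (cbox 0 1) (\<lambda>u. of_real (k u) * (of_real u * cos (z * of_real u)))) (at z within UNIV)"
  proof (rule leibniz_rule_field_derivative)
    show "continuous_on (UNIV \<times> cbox 0 1) (\<lambda>(z, u). complex_of_real (k u) * (of_real u * cos (z * of_real u)))"
      unfolding split_beta using k2 by (auto intro!: continuous_intros)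
  qed (use sine_transform_integrable[OF assms] in \<open>auto intro!: derivative_eq_intros\<close>)
  then show ?thesis by (simp add: sine_transform_def[abs_def])
qed

lemma sine_transform_diff:
  assumes "continuous_on {0..1} k" "continuous_on {0..1} l"
  shows "sine_transform (\<lambda>u. k u - l u) z = sine_transform k z - sine_transform l z"
  unfolding sine_transform_def
  by (subst integral_diff[symmetric]) (use sine_transform_integrable assms in \<open>auto simp: left_diff_distrib\<close>)

text \<open>The bound \<open>b\<close> on the sine is a parameter because two are used: exp |Im z|
  for large z, and |z| exp |Im z| near 0, where the factor |z| compensates the division by
  \<rho>.\<close>

lemma sine_transform_bound:
  assumes k: "continuous_on {0..1} k" and b: "\<And>u. u \<in> {0..1} \<Longrightarrow> cmod (sin (z * of_real u)) \<le> b"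
  shows "cmod (sine_transform k z) \<le> b * integral {0..1} (\<lambda>u. \<bar>k u\<bar>)"
proof -
  have "cmod (sine_transform k z) \<le> integral {0..1} (\<lambda>u. b * \<bar>k u\<bar>)"
    unfolding sine_transform_def
  proof (rule integral_norm_bound_integral)
    show "(\<lambda>u. b * \<bar>k u\<bar>) integrable_on {0..1}" by (intro integrable_continuous_interval continuous_intros k)
    fix u :: real assume "u \<in> {0..1}"
    then show "cmod (of_real (k u) * sin (z * of_real u)) \<le> b * \<bar>k u\<bar>"
      using mult_left_mono[OF b[of u], of "\<bar>k u\<bar>"] by (simp add: norm_mult mult.commute)
  qed (rule sine_transform_integrable[OF k])
  then show ?thesis by simp
qed

lemma abs_Im_mult_le: "u \<in> {0..1} \<Longrightarrow> \<bar>Im (z * of_real u)\<bar> \<le> \<bar>Im z\<bar>"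
  by (auto simp: abs_mult intro: mult_left_le)

lemma sine_transform_le_exp:
  assumes "continuous_on {0..1} k"
  shows "cmod (sine_transform k z) \<le> exp \<bar>Im z\<bar> * integral {0..1} (\<lambda>u. \<bar>k u\<bar>)"
  using order_trans[OF norm_sin_le_exp_Im] abs_Im_mult_le by (intro sine_transform_bound[OF assms]) simp

lemma sine_transform_le_norm_exp:
  assumes "continuous_on {0..1} k"
  shows "cmod (sine_transform k z) \<le> cmod z * exp \<bar>Im z\<bar> * integral {0..1} (\<lambda>u. \<bar>k u\<bar>)"
proof (rule sine_transform_bound[OF assms])
  fix u :: real assume u: "u \<in> {0..1}"
  have "cmod (sin (z * of_real u)) \<le> cmod (z * of_real u) * exp \<bar>Im (z * of_real u)\<bar>" by (rule norm_sin_le_norm_exp_Im)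
  also have "\<dots> \<le> cmod z * exp \<bar>Im z\<bar>"
    using u abs_Im_mult_le[OF u, of z] by (intro mult_mono) (auto simp: norm_mult intro: mult_left_le)
  finally show "cmod (sin (z * of_real u)) \<le> cmod z * exp \<bar>Im z\<bar>" .
qed

lemma sine_transform_polynomial_decay:
  assumes "real_polynomial_function p"
  obtains D where "\<And>z. z \<noteq> 0 \<Longrightarrow> cmod (sine_transform p z) \<le> D * exp \<bar>Im z\<bar> / cmod z"
proof -
  obtain p' where p': "real_polynomial_function p'" "\<And>x. (p has_real_derivative p' x) (at x)"
    using has_real_derivative_polynomial_function[OF assms] by blast
  have c: "continuous_on A p" "continuous_on A p'" for A
    using assms p'(1) continuous_on_polymonial_function real_polynomial_function_eq by auto
  \<comment> \<open>Integration by parts.\<close>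
  define D where "D = \<bar>p 1\<bar> + \<bar>p 0\<bar> + integral {0..1} (\<lambda>u. \<bar>p' u\<bar>)"
  show ?thesis
  proof (rule that[of D])
    fix z :: complex assume z: "z \<noteq> 0"
    let ?I = "integral {0..1} (\<lambda>u. of_real (p' u) * cos (z * of_real u) / z)"
    have int: "(\<lambda>u. of_real (p' u) * cos (z * of_real u) / z) integrable_on {0..1}"
      by (intro integrable_continuous_interval continuous_intros c) (use z in auto)
    have "((\<lambda>u. of_real (p u) * sin (z * of_real u) - of_real (p' u) * cos (z * of_real u) / z) has_integral
       (- of_real (p 1) * cos (z * of_real 1) / z - - of_real (p 0) * cos (z * of_real 0) / z)) {0..1}"
    proof (rule fundamental_theorem_of_calculus)
      fix u :: real
      have 1: "((\<lambda>u. complex_of_real (p u)) has_vector_derivative of_real (p' u)) (at u within {0..1})"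
        using p'(2)[of u] by (intro has_vector_derivative_of_real) (auto simp: has_real_derivative_iff_has_vector_derivative intro: has_vector_derivative_at_within)
      have "((\<lambda>w. - cos (z * w) / z) has_field_derivative sin (z * of_real u)) (at (of_real u))"
        using z by (auto intro!: derivative_eq_intros)
      then have "((\<lambda>u. - cos (z * of_real u) / z) has_vector_derivative sin (z * of_real u)) (at u within {0..1})"
        by (intro has_vector_derivative_real_field) (auto intro: has_field_derivative_at_within)
      from has_vector_derivative_mult[OF 1 this]
      show "((\<lambda>u. - of_real (p u) * cos (z * of_real u) / z) has_vector_derivative
          of_real (p u) * sin (z * of_real u) - of_real (p' u) * cos (z * of_real u) / z) (at u within {0..1})"
        by (simp add: mult_ac)
    qed simp
    from has_integral_add[OF this integrable_integral[OF int]]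
    have "sine_transform p z = - of_real (p 1) * cos z / z + of_real (p 0) / z + ?I"
      unfolding sine_transform_def by (simp add: integral_unique)
    then have "cmod (sine_transform p z) \<le> cmod (of_real (p 1) * cos z / z) + cmod (of_real (p 0) / z) + cmod ?I"
      by (metis (no_types, lifting) minus_divide_left minus_mult_left norm_minus_cancel norm_triangle_mono norm_triangle_ineq order_refl)
    also have "\<dots> \<le> \<bar>p 1\<bar> * exp \<bar>Im z\<bar> / cmod z + \<bar>p 0\<bar> * exp \<bar>Im z\<bar> / cmod z
        + integral {0..1} (\<lambda>u. \<bar>p' u\<bar>) * exp \<bar>Im z\<bar> / cmod z"
    proof (intro add_mono)
      show "cmod (of_real (p 1) * cos z / z) \<le> \<bar>p 1\<bar> * exp \<bar>Im z\<bar> / cmod z"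
        by (simp add: norm_mult norm_divide divide_right_mono mult_left_mono norm_cos_le_exp_Im)
      show "cmod (of_real (p 0) / z) \<le> \<bar>p 0\<bar> * exp \<bar>Im z\<bar> / cmod z"
        by (simp add: norm_divide divide_right_mono mult_le_cancel_left1)
      have "cmod ?I \<le> integral {0..1} (\<lambda>u. \<bar>p' u\<bar> * (exp \<bar>Im z\<bar> / cmod z))"
      proof (rule integral_norm_bound_integral[OF int])
        show "(\<lambda>u. \<bar>p' u\<bar> * (exp \<bar>Im z\<bar> / cmod z)) integrable_on {0..1}"
          by (intro integrable_continuous_interval continuous_intros c) (use z in auto)
        fix u :: real assume u: "u \<in> {0..1}"
        have "cmod (cos (z * of_real u)) \<le> exp \<bar>Im z\<bar>"
          using norm_cos_le_exp_Im[of "z * of_real u"] abs_Im_mult_le[OF u, of z] by (meson exp_le_cancel_iff order_trans)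
        then show "cmod (of_real (p' u) * cos (z * of_real u) / z) \<le> \<bar>p' u\<bar> * (exp \<bar>Im z\<bar> / cmod z)"
          by (simp add: norm_mult norm_divide divide_right_mono mult_left_mono)
      qed
      then show "cmod ?I \<le> integral {0..1} (\<lambda>u. \<bar>p' u\<bar>) * exp \<bar>Im z\<bar> / cmod z" by simp
    qed
    also have "\<dots> = D * exp \<bar>Im z\<bar> / cmod z" by (simp add: D_def add_divide_distrib distrib_right)
    finally show "cmod (sine_transform p z) \<le> D * exp \<bar>Im z\<bar> / cmod z" .
  qed
qed

text \<open>The decay is measured relative to exp |Im z|, uniformly in the direction of z. A uniform
  polynomial approximation of k contributes half of \<eta>; the polynomial itself decays like 1/|z|
  and contributes the other half.\<close>

lemma sine_transform_Riemann_Lebesgue: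
  assumes k: "continuous_on {0..1} k" and \<eta>: "\<eta> > 0"
  obtains R where "\<And>z. cmod z \<ge> R \<Longrightarrow> cmod (sine_transform k z) \<le> \<eta> * exp \<bar>Im z\<bar>"
proof -
  obtain p where p: "real_polynomial_function p" "\<And>u. u \<in> {0..1} \<Longrightarrow> \<bar>k u - p u\<bar> < \<eta> / 2"
    using Stone_Weierstrass_real_polynomial_function[of "{0..1::real}" k "\<eta> / 2"] k \<eta> by auto
  have pc: "continuous_on {0..1} p"
    using p(1) continuous_on_polymonial_function real_polynomial_function_eq by auto
  obtain D where D: "\<And>z. z \<noteq> 0 \<Longrightarrow> cmod (sine_transform p z) \<le> D * exp \<bar>Im z\<bar> / cmod z"
    using sine_transform_polynomial_decay[OF p(1)] by blast
  show ?thesis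
  \<comment> \<open>From |z| = 2 D / \<eta> on the polynomial part is at most half of the bound; the
    1 keeps z away from 0.\<close>
  proof (rule that[of "max 1 (2 * D / \<eta>)"])
    fix z assume z: "max 1 (2 * D / \<eta>) \<le> cmod z"
    then have z0: "z \<noteq> 0" and "D \<le> \<eta> / 2 * cmod z" using \<eta> by (auto simp: field_simps)
    then have "D / cmod z \<le> \<eta> / 2" by (simp add: field_simps)
    then have "D / cmod z * exp \<bar>Im z\<bar> \<le> \<eta> / 2 * exp \<bar>Im z\<bar>" by (intro mult_right_mono) auto
    with D[OF z0] have 1: "cmod (sine_transform p z) \<le> \<eta> / 2 * exp \<bar>Im z\<bar>"
      by (metis (no_types, opaque_lifting) order_trans times_divide_eq_left mult.commute)
    have "integral {0..1} (\<lambda>u. \<bar>k u - p u\<bar>) \<le> integral {0..1} (\<lambda>u::real. \<eta> / 2)"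
      by (intro integral_le integrable_continuous_interval continuous_intros k pc) (use p(2) in \<open>auto intro: less_imp_le\<close>)
    then have "exp \<bar>Im z\<bar> * integral {0..1} (\<lambda>u. \<bar>k u - p u\<bar>) \<le> exp \<bar>Im z\<bar> * (\<eta> / 2)"
      by (intro mult_left_mono) auto
    then have 2: "cmod (sine_transform (\<lambda>u. k u - p u) z) \<le> \<eta> / 2 * exp \<bar>Im z\<bar>"
      using order_trans[OF sine_transform_le_exp[OF continuous_on_diff[OF k pc]]] by (simp only: mult.commute)
    have "sine_transform k z = sine_transform (\<lambda>u. k u - p u) z + sine_transform p z"
      by (simp add: sine_transform_diff k pc)
    then show "cmod (sine_transform k z) \<le> \<eta> * exp \<bar>Im z\<bar>"
      using 1 2 norm_triangle_ineq[of "sine_transform (\<lambda>u. k u - p u) z" "sine_transform p z"] by simp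
  qed
qed

section \<open>Characteristic functions of continuous kernels\<close>

definition char_fun :: "(real \<Rightarrow> real) \<Rightarrow> complex \<Rightarrow> complex" where
  "char_fun k \<rho> = (if \<rho> = 0 then of_real (pi + pi * integral {0..1} (\<lambda>u. k u * u))
     else (sin (of_real pi * \<rho>) + sine_transform k (of_real pi * \<rho>)) / \<rho>)"

lemma integral_of_real_complex:
  fixes f :: "real \<Rightarrow> real"
  assumes "f integrable_on S"
  shows "integral S (\<lambda>x. complex_of_real (f x)) = of_real (integral S f)"
  using has_integral_of_real[OF integrable_integral[OF assms]] by (rule integral_unique)

text \<open>The numerator is entire and vanishes at 0, so the singularity is removable; the value
  prescribed at 0 is the derivative of the numerator there.\<close>

lemma char_fun_holomorphic:
  assumes k: "continuous_on {0..1} k"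
  shows "char_fun k holomorphic_on UNIV"
proof -
  define H where "H \<rho> = sin (of_real pi * \<rho>) + sine_transform k (of_real pi * \<rho>)" for \<rho>
  have H: "(H has_field_derivative of_real pi * cos (of_real pi * \<rho>)
      + integral {0..1} (\<lambda>u. of_real (k u) * (of_real u * cos (of_real pi * \<rho> * of_real u))) * of_real pi) (at \<rho>)" for \<rho>
    unfolding H_def[abs_def]
    by (rule DERIV_add[OF _ DERIV_chain2[OF sine_transform_deriv[OF k]]]) (auto intro!: derivative_eq_intros)
  then have "H holomorphic_on UNIV" by (auto simp: holomorphic_on_open)
  then have "(\<lambda>\<rho>. if \<rho> = 0 then deriv H 0 else (H \<rho> - H 0) / (\<rho> - 0)) holomorphic_on UNIV"
    by (rule pole_lemma_open) simp
  moreover have "deriv H 0 = of_real (pi + pi * integral {0..1} (\<lambda>u. k u * u))"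
  proof -
    have "(\<lambda>u. k u * u) integrable_on {0..1}" by (intro integrable_continuous_interval continuous_intros k)
    from integral_of_real_complex[OF this] show ?thesis
      using DERIV_imp_deriv[OF H[of 0]] by (simp add: mult.commute)
  qed
  moreover have "H 0 = 0" by (simp add: H_def sine_transform_def)
  ultimately show ?thesis by (simp add: char_fun_def[abs_def] H_def cong: if_cong)
qed

lemma char_fun_diff:
  assumes k: "continuous_on {0..1} k" and l: "continuous_on {0..1} l"
  shows "char_fun k \<rho> - char_fun l \<rho>
    = (if \<rho> = 0 then of_real (pi * integral {0..1} (\<lambda>u. (k u - l u) * u))
        else sine_transform (\<lambda>u. k u - l u) (of_real pi * \<rho>) / \<rho>)"
proof -
  have "integral {0..1} (\<lambda>u. (k u - l u) * u) = integral {0..1} (\<lambda>u. k u * u) - integral {0..1} (\<lambda>u. l u * u)"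
    unfolding left_diff_distrib by (intro integral_diff integrable_continuous_interval continuous_intros k l)
  then show ?thesis
    by (simp add: char_fun_def sine_transform_diff[OF k l] diff_divide_distrib[symmetric] right_diff_distrib)
qed

lemma char_fun_diff_bound:
  assumes k: "continuous_on {0..1} k" and l: "continuous_on {0..1} l"
  shows "cmod (char_fun k \<rho> - char_fun l \<rho>) \<le> pi * exp (pi * \<bar>Im \<rho>\<bar>) * integral {0..1} (\<lambda>u. \<bar>k u - l u\<bar>)"
proof (cases "\<rho> = 0")
  case False
  have "cmod (sine_transform (\<lambda>u. k u - l u) (of_real pi * \<rho>))
      \<le> cmod (of_real pi * \<rho>) * exp \<bar>Im (of_real pi * \<rho>)\<bar> * integral {0..1} (\<lambda>u. \<bar>k u - l u\<bar>)"
    by (intro sine_transform_le_norm_exp continuous_intros k l)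
  then show ?thesis using False unfolding char_fun_diff[OF k l]
    by (simp add: norm_divide norm_mult abs_mult divide_simps mult_ac)
next
  case True
  have "norm (integral {0..1} (\<lambda>u. (k u - l u) * u)) \<le> integral {0..1} (\<lambda>u. \<bar>k u - l u\<bar>)"
    by (intro integral_norm_bound_integral integrable_continuous_interval continuous_intros k l)
       (auto simp: abs_mult intro: mult_left_le)
  then show ?thesis using True unfolding char_fun_diff[OF k l] by (simp add: norm_mult)
qed

text \<open>Keeps the decay 1/|\<rho>| that the lower bound for the characteristic function also
  has. The bound valid near 0 lacks it and would be too weak at distant zeros.\<close>

lemma char_fun_diff_bound_away:
  assumes k: "continuous_on {0..1} k" and l: "continuous_on {0..1} l" and \<rho>: "\<rho> \<noteq> 0"
  shows "cmod (char_fun k \<rho> - char_fun l \<rho>) \<le> exp (pi * \<bar>Im \<rho>\<bar>) * integral {0..1} (\<lambda>u. \<bar>k u - l u\<bar>) / cmod \<rho>"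
proof -
  have "cmod (sine_transform (\<lambda>u. k u - l u) (of_real pi * \<rho>))
      \<le> exp \<bar>Im (of_real pi * \<rho>)\<bar> * integral {0..1} (\<lambda>u. \<bar>k u - l u\<bar>)"
    by (intro sine_transform_le_exp continuous_intros k l)
  then show ?thesis using \<rho> unfolding char_fun_diff[OF k l]
    by (simp add: norm_divide abs_mult divide_right_mono)
qed

lemma char_fun_lower_bound:
  assumes k: "continuous_on {0..1} k" and r: "r > 0"
  obtains c R where "c > 0"
    "\<And>\<rho>. cmod \<rho> \<ge> R \<Longrightarrow> \<rho> \<noteq> 0 \<Longrightarrow> (\<And>n::int. cmod (\<rho> - of_int n) \<ge> r) \<Longrightarrow>
       c * exp (pi * \<bar>Im \<rho>\<bar>) / cmod \<rho> \<le> cmod (char_fun k \<rho>)"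
proof -
  obtain c where c: "c > 0"
    "\<And>\<rho>. (\<And>n::int. cmod (\<rho> - of_int n) \<ge> r) \<Longrightarrow> c * exp (pi * \<bar>Im \<rho>\<bar>) \<le> cmod (sin (of_real pi * \<rho>))"
    using sin_pi_lower_bound[OF r] by blast
  obtain R where R: "\<And>z. cmod z \<ge> R \<Longrightarrow> cmod (sine_transform k z) \<le> c / 2 * exp \<bar>Im z\<bar>"
    using sine_transform_Riemann_Lebesgue[OF k, of "c / 2"] c(1) by auto
  show ?thesis
  \<comment> \<open>The sine transform, taken at pi \<rho>, may consume half of the lower bound for
    the sine; this happens for |pi \<rho>| \<ge> R.\<close>
  proof (rule that[of "c / 2" "R / pi"])
    fix \<rho> :: complex assume \<rho>: "cmod \<rho> \<ge> R / pi" "\<rho> \<noteq> 0" and far: "\<And>n::int. cmod (\<rho> - of_int n) \<ge> r"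
    have "cmod (of_real pi * \<rho>) \<ge> R" using \<rho>(1) by (simp add: norm_mult field_simps)
    from R[OF this] have "cmod (sine_transform k (of_real pi * \<rho>)) \<le> c / 2 * exp (pi * \<bar>Im \<rho>\<bar>)" by (simp add: abs_mult)
    with c(2)[OF far] norm_diff_ineq[of "sin (of_real pi * \<rho>)" "sine_transform k (of_real pi * \<rho>)"]
    have "c / 2 * exp (pi * \<bar>Im \<rho>\<bar>) \<le> cmod (sin (of_real pi * \<rho>) + sine_transform k (of_real pi * \<rho>))" by simp
    then show "c / 2 * exp (pi * \<bar>Im \<rho>\<bar>) / cmod \<rho> \<le> cmod (char_fun k \<rho>)"
      using \<rho>(2) by (simp only: char_fun_def norm_divide if_False) (intro divide_right_mono, auto)
  qed (use c in auto)
qed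

section \<open>Stability of the zeros under perturbation of the kernel\<close>

lemma finite_separation:
  fixes Z :: "'a::metric_space set"
  assumes Z: "finite Z" and pos: "\<And>z. z \<in> Z \<Longrightarrow> g z > 0" and e: "e > 0"
  obtains r where "r > 0" "r < e" "\<And>z. z \<in> Z \<Longrightarrow> r < g z"
    "\<And>z w. z \<in> Z \<Longrightarrow> w \<in> Z \<Longrightarrow> z \<noteq> w \<Longrightarrow> 2 * r < dist z w"
proof -
  define P where "P = {p \<in> Z \<times> Z. fst p \<noteq> snd p}"
  \<comment> \<open>Including e keeps D nonempty even if Z is empty.\<close>
  define D where "D = insert e (g ` Z \<union> (\<lambda>p. dist (fst p) (snd p) / 2) ` P)"
  have P: "finite P" using Z by (auto simp: P_def)
  have fin: "finite D" "D \<noteq> {}" using Z P by (auto simp: D_def)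
  have "Min D > 0" using fin pos e by (auto simp: D_def P_def)
  define r where "r = Min D / 2"
  have r: "r > 0" "\<And>d. d \<in> D \<Longrightarrow> r < d"
    using \<open>Min D > 0\<close> Min_le[OF fin(1)] by (fastforce simp: r_def)+
  show ?thesis
  proof (rule that[of r])
    fix z w assume "z \<in> Z" "w \<in> Z" "z \<noteq> w"
    then have "(z, w) \<in> P" by (auto simp: P_def)
    then have "dist z w / 2 \<in> D" by (force simp: D_def)
    from r(2)[OF this] show "2 * r < dist z w" by simp
  qed (use r in \<open>auto simp: D_def\<close>)
qed

text \<open>The circle |\<rho>| = R separates two regimes. Inside, compactness bounds the function
  away from 0 off the discs; outside, the explicit lower bound near infinity takes over. A single
  \<delta> has to beat both.\<close>

lemma char_fun_zeros_stable:
  assumes k: "continuous_on {0..1} k" and \<epsilon>: "\<epsilon> > 0"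
  shows "\<exists>\<delta>>0. \<forall>l. continuous_on {0..1} l \<longrightarrow> integral {0..1} (\<lambda>u. \<bar>k u - l u\<bar>) \<le> \<delta> \<longrightarrow>
       (\<exists>\<phi>. bij_betw \<phi> (zeros_mult (char_fun k)) (zeros_mult (char_fun l)) \<and>
         (\<forall>p \<in> zeros_mult (char_fun k). cmod (fst p - fst (\<phi> p)) \<le> \<epsilon>))"
proof -
  \<comment> \<open>Radius at most \<epsilon>/2 puts any two points of a disc within \<epsilon>;
    radius at most 1/4 separates discs about different integers and keeps them off the circle of
    half-integer radius R.\<close>
  define r0 where "r0 = min (\<epsilon> / 2) (1 / 4)"
  have r0: "r0 > 0" "r0 \<le> \<epsilon> / 2" "r0 \<le> 1 / 4" using \<epsilon> by (auto simp: r0_def)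
  obtain c R1 where c: "c > 0" and lower: "\<And>\<rho>. cmod \<rho> \<ge> R1 \<Longrightarrow> \<rho> \<noteq> 0 \<Longrightarrow> (\<And>n::int. cmod (\<rho> - of_int n) \<ge> r0) \<Longrightarrow>
       c * exp (pi * \<bar>Im \<rho>\<bar>) / cmod \<rho> \<le> cmod (char_fun k \<rho>)"
    using char_fun_lower_bound[OF k r0(1)] by blast
  define M where "M = nat \<lceil>max R1 0\<rceil> + 1"
  define R where "R = real M - 1 / 2"
  have "M \<ge> 1" "R1 + 1 \<le> real M" unfolding M_def by linarith+
  then have R: "R \<ge> R1" "R > 0" by (auto simp: R_def)
  define N where "N = {n::int. \<bar>n\<bar> \<ge> int M}"
  have low: "c * exp (pi * \<bar>Im \<rho>\<bar>) / cmod \<rho> \<le> cmod (char_fun k \<rho>)"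
    if \<rho>: "cmod \<rho> \<ge> R" "\<And>n. n \<in> N \<Longrightarrow> \<rho> \<notin> ball (of_int n) r0" for \<rho>
  proof (rule lower)
    show "\<rho> \<noteq> 0" "cmod \<rho> \<ge> R1" using \<rho>(1) R by auto
    fix n :: int
    show "r0 \<le> cmod (\<rho> - of_int n)"
    proof (cases "n \<in> N")
      case True
      then show ?thesis using \<rho>(2)[of n] by (simp add: dist_norm norm_minus_commute)
    next
      \<comment> \<open>An integer with |n| \<le> M-1 has distance at least 1/2 from every \<rho>
        with |\<rho>| \<ge> R = M - 1/2, so only discs about the large integers have to be
        removed.\<close>
      case False
      then have "\<bar>real_of_int n\<bar> \<le> real M - 1" by (auto simp: N_def)
      moreover have "cmod \<rho> - cmod (of_int n) \<le> cmod (\<rho> - of_int n)" by (rule norm_triangle_ineq2)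
      ultimately show ?thesis using \<rho>(1) r0 by (simp add: R_def)
    qed
  qed
  have big: "cmod w > R" if "w \<in> cball (of_int n) r0" "n \<in> N" for w n
  proof -
    have "real M \<le> \<bar>real_of_int n\<bar>" using that(2) unfolding N_def by (simp add: abs_if split: if_splits)
    moreover have "cmod (of_int n) - cmod w \<le> cmod (of_int n - w)" by (rule norm_triangle_ineq2)
    ultimately show ?thesis using that(1) r0 by (simp add: R_def dist_norm)
  qed
  have nz: "char_fun k \<rho> \<noteq> 0" if "cmod \<rho> = R" for \<rho>
  proof -
    have "\<rho> \<notin> ball (of_int n) r0" if "n \<in> N" for n
      using big[OF _ that, of \<rho>] \<open>cmod \<rho> = R\<close> by auto
    moreover have "c * exp (pi * \<bar>Im \<rho>\<bar>) / cmod \<rho> > 0" using c R that by simp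
    ultimately show ?thesis using low[of \<rho>] that by fastforce
  qed
  note hol = char_fun_holomorphic[OF k]
  define Z where "Z = {z \<in> ball 0 R. char_fun k z = 0}"
  have Zfin: "finite Z" unfolding Z_def
    using R by (intro finite_zeros_ball[OF hol nz[of "of_real R"]]) auto
  obtain r1 where r1: "r1 > 0" "r1 < \<epsilon> / 2" "\<And>z. z \<in> Z \<Longrightarrow> r1 < R - cmod z"
    and sep: "\<And>z w. z \<in> Z \<Longrightarrow> w \<in> Z \<Longrightarrow> z \<noteq> w \<Longrightarrow> 2 * r1 < dist z w"
    using finite_separation[OF Zfin, of "\<lambda>z. R - cmod z" "\<epsilon> / 2"] \<epsilon> by (auto simp: Z_def)
  have small: "cmod w < R" if "w \<in> cball z r1" "z \<in> Z" for w z
    using r1(3)[OF that(2)] that(1) norm_triangle_ineq2[of w z] by (simp add: dist_norm norm_minus_commute)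
  define Q where "Q = cball 0 R - (\<Union>z\<in>Z. ball z r1)"
  have "compact Q" unfolding Q_def by (intro compact_diff) auto
  moreover have "continuous_on Q (char_fun k)"
    using holomorphic_on_imp_continuous_on[OF hol] by (rule continuous_on_subset) auto
  moreover have "char_fun k \<rho> \<noteq> 0" if "\<rho> \<in> Q" for \<rho>
    using that nz[of \<rho>] r1(1) by (cases "cmod \<rho> = R") (auto simp: Q_def Z_def)
  ultimately obtain m where m: "m > 0" "\<And>\<rho>. \<rho> \<in> Q \<Longrightarrow> m \<le> cmod (char_fun k \<rho>)"
    using compact_nonzero_lower_bound[of Q "char_fun k"] by blast
  \<comment> \<open>The first entry keeps the perturbation below the lower bound outside the circle.
    The second makes pi exp(pi R) \<delta> at most m/2, which is below the minimum m on Q.\<close>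
  define \<delta> where "\<delta> = min (c / 2) (m / (2 * pi * exp (pi * R)))"
  have \<delta>: "\<delta> > 0" "\<delta> < c" "pi * exp (pi * R) * \<delta> < m"
  proof -
    show "\<delta> > 0" "\<delta> < c" using c m by (auto simp: \<delta>_def min_less_iff_disj)
    have "pi * exp (pi * R) * \<delta> \<le> pi * exp (pi * R) * (m / (2 * pi * exp (pi * R)))"
      by (intro mult_left_mono) (auto simp: \<delta>_def)
    also have "\<dots> = m / 2" by simp
    finally show "pi * exp (pi * R) * \<delta> < m" using m by simp
  qed
  define C where "C = Z \<union> of_int ` N"
  define rad where "rad z = (if cmod z < R then r1 else r0)" for z
  have radZ: "rad z = r1" if "z \<in> Z" for z using that by (auto simp: rad_def Z_def)
  have radN: "rad (of_int n) = r0" if "n \<in> N" for n using big[OF _ that, of "of_int n"] r0 by (auto simp: rad_def)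
  have rad: "rad z > 0" "rad z \<le> \<epsilon> / 2" for z using r0 r1 by (auto simp: rad_def)
  have disj: "cball z (rad z) \<inter> cball w (rad w) = {}" if "z \<in> C" "w \<in> C" "z \<noteq> w" for z w
  proof -
    have ZN: "cball z (rad z) \<inter> cball (of_int n) (rad (of_int n)) = {}" if "z \<in> Z" "n \<in> N" for z n
      using small[OF _ that(1)] big[OF _ that(2)] unfolding radZ[OF that(1)] radN[OF that(2)] by fastforce
    have far: "cball z s \<inter> cball w s = {}" if "2 * s < dist z w" for z w :: complex and s
      using that by (auto simp: disjoint_iff) (smt (verit) dist_commute dist_triangle)
    from that(1,2) consider "z \<in> Z" "w \<in> Z" | n where "z \<in> Z" "n \<in> N" "w = of_int n"
      | n where "w \<in> Z" "n \<in> N" "z = of_int n" | n n' where "n \<in> N" "n' \<in> N" "z = of_int n" "w = of_int n'"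
      unfolding C_def by blast
    then show ?thesis
    proof cases
      case 1
      then show ?thesis using far[OF sep[OF 1 that(3)]] by (simp add: radZ)
    next
      case 4
      then have "1 \<le> \<bar>n - n'\<bar>" using that(3) by auto
      then have "1 \<le> \<bar>real_of_int (n - n')\<bar>" by linarith
      also have "\<dots> = dist z w" unfolding 4 dist_norm of_int_diff[symmetric] norm_of_int by simp
      finally have "2 * r0 < dist z w" using r0 by simp
      from far[OF this] show ?thesis unfolding 4 radN[OF 4(1)] radN[OF 4(2)] .
    qed (use ZN in \<open>auto simp: Int_commute\<close>)
  qed
  show ?thesis
  proof (intro exI[of _ \<delta>] conjI allI impI \<delta>(1))
    fix l assume l: "continuous_on {0..1} l" and kl: "integral {0..1} (\<lambda>u. \<bar>k u - l u\<bar>) \<le> \<delta>"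
    have less: "cmod (char_fun k \<rho> - char_fun l \<rho>) < cmod (char_fun k \<rho>)"
      if off: "\<And>c. c \<in> C \<Longrightarrow> \<rho> \<notin> ball c (rad c)" for \<rho>
    proof (cases "cmod \<rho> \<le> R")
      case True
      have "cmod (char_fun k \<rho> - char_fun l \<rho>) \<le> pi * exp (pi * \<bar>Im \<rho>\<bar>) * integral {0..1} (\<lambda>u. \<bar>k u - l u\<bar>)"
        by (rule char_fun_diff_bound[OF k l])
      also have "\<dots> \<le> pi * exp (pi * R) * \<delta>"
        using True abs_Im_le_cmod[of \<rho>] kl \<delta>(1) by (intro mult_mono) (auto intro!: integral_nonneg integrable_continuous_interval continuous_intros k l)
      also have "\<dots> < m" by (rule \<delta>)
      also have "m \<le> cmod (char_fun k \<rho>)"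
      proof (rule m)
        show "\<rho> \<in> Q" using True off radZ unfolding Q_def C_def by auto
      qed
      finally show ?thesis .
    next
      case False
      then have \<rho>: "\<rho> \<noteq> 0" "cmod \<rho> > 0" "cmod \<rho> \<ge> R" using R by auto
      have "cmod (char_fun k \<rho> - char_fun l \<rho>) \<le> exp (pi * \<bar>Im \<rho>\<bar>) * integral {0..1} (\<lambda>u. \<bar>k u - l u\<bar>) / cmod \<rho>"
        by (rule char_fun_diff_bound_away[OF k l \<rho>(1)])
      also have "\<dots> \<le> exp (pi * \<bar>Im \<rho>\<bar>) * \<delta> / cmod \<rho>"
        using kl by (intro divide_right_mono mult_left_mono) auto
      also have "\<dots> < c * exp (pi * \<bar>Im \<rho>\<bar>) / cmod \<rho>"
        using \<delta>(2) \<rho>(2) by (intro divide_strict_right_mono) auto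
      also have "\<dots> \<le> cmod (char_fun k \<rho>)"
        by (rule low[OF \<rho>(3)]) (use off radN in \<open>auto simp: C_def\<close>)
      finally show ?thesis .
    qed
    have "\<exists>\<phi>. bij_betw \<phi> (zeros_mult (char_fun k)) (zeros_mult (char_fun l)) \<and>
      (\<forall>p \<in> zeros_mult (char_fun k). \<exists>c\<in>C. fst p \<in> ball c (rad c) \<and> fst (\<phi> p) \<in> ball c (rad c))"
      by (rule Rouche_zeros_mult_bij[OF hol char_fun_holomorphic[OF l] rad(1) disj less])
    then obtain \<phi> where \<phi>: "bij_betw \<phi> (zeros_mult (char_fun k)) (zeros_mult (char_fun l))"
      "\<forall>p \<in> zeros_mult (char_fun k). \<exists>c\<in>C. fst p \<in> ball c (rad c) \<and> fst (\<phi> p) \<in> ball c (rad c)"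
      by blast
    have "cmod (fst p - fst (\<phi> p)) \<le> \<epsilon>" if "p \<in> zeros_mult (char_fun k)" for p
    proof -
      from bspec[OF \<phi>(2) that] obtain z where z: "fst p \<in> ball z (rad z)" "fst (\<phi> p) \<in> ball z (rad z)"
        by (elim bexE conjE)
      have "dist (fst p) (fst (\<phi> p)) \<le> dist z (fst p) + dist z (fst (\<phi> p))" by (rule dist_triangle3)
      then show ?thesis using z rad(2)[of z] by (simp add: dist_norm)
    qed
    with \<phi>(1) show "\<exists>\<phi>. bij_betw \<phi> (zeros_mult (char_fun k)) (zeros_mult (char_fun l)) \<and>
         (\<forall>p \<in> zeros_mult (char_fun k). cmod (fst p - fst (\<phi> p)) \<le> \<epsilon>)" by blast
  qed
qed

section \<open>The initial value problem near \<open>\<rho> = 0\<close>\<close>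

text \<open>A Gronwall estimate for D'' = g with zero initial data. The potential enters only
  through its majorant p and the integral of p, so integrability suffices; the bound is linear in
  the inhomogeneity \<eta>.\<close>

lemma volterra_bound:
  fixes D D' g :: "real \<Rightarrow> complex" and p :: "real \<Rightarrow> real"
  assumes D0: "D 0 = 0" and b: "b > 0"
    and deriv: "\<And>x. x \<in> {0..b} \<Longrightarrow> (D has_vector_derivative D' x) (at x within {0..b})"
    and gint: "\<And>x. x \<in> {0..b} \<Longrightarrow> g integrable_on {0..x}"
    and D': "\<And>x. x \<in> {0..b} \<Longrightarrow> D' x = integral {0..x} g"
    and g: "\<And>t. t \<in> {0..b} \<Longrightarrow> cmod (g t) \<le> p t * cmod (D t) + \<eta>"
    and p: "p integrable_on {0..b}" "\<And>t. t \<in> {0..b} \<Longrightarrow> 0 \<le> p t"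
    and L: "integral {0..b} p \<le> L" "L > 0" and \<eta>: "\<eta> \<ge> 0"
  shows "cmod (D b) \<le> 2 * \<eta> * b\<^sup>2 * exp (2 * L * b)"
proof -
  have Dc: "continuous_on {0..b} D"
    using deriv by (meson continuous_on_eq_continuous_within has_vector_derivative_continuous)
  \<comment> \<open>In this weighted sup norm the Volterra operator is a contraction with constant 1/2.\<close>
  have "continuous_on {0..b} (\<lambda>t. exp (- (2 * L * t)) * cmod (D t))" by (intro continuous_intros Dc)
  then obtain x0 where x0: "x0 \<in> {0..b}"
    and max: "\<And>t. t \<in> {0..b} \<Longrightarrow> exp (- (2 * L * t)) * cmod (D t) \<le> exp (- (2 * L * x0)) * cmod (D x0)"
    using continuous_attains_sup[of "{0..b}" "\<lambda>t. exp (- (2 * L * t)) * cmod (D t)"] b by fastforce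
  define B where "B = exp (- (2 * L * x0)) * cmod (D x0)"
  have B0: "B \<ge> 0" by (simp add: B_def)
  have DB: "cmod (D t) \<le> B * exp (2 * L * t)" if "t \<in> {0..b}" for t
    using max[OF that] unfolding B_def[symmetric] by (simp add: exp_minus field_simps)
  have Dx0: "cmod (D x0) = B * exp (2 * L * x0)" by (simp add: B_def exp_minus)
  have D'B: "cmod (D' x) \<le> L * B * exp (2 * L * x) + \<eta> * b" if x: "x \<in> {0..b}" for x
  proof -
    have px: "p integrable_on {0..x}" using x by (intro integrable_on_subinterval[OF p(1)]) auto
    have "cmod (D' x) \<le> integral {0..x} (\<lambda>t. p t * (B * exp (2 * L * x)) + \<eta>)"
      unfolding D'[OF x]
    proof (rule integral_norm_bound_integral[OF gint[OF x]])
      show "(\<lambda>t. p t * (B * exp (2 * L * x)) + \<eta>) integrable_on {0..x}"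
        by (intro integrable_add integrable_on_mult_left px) auto
      fix t assume t: "t \<in> {0..x}"
      then have tb: "t \<in> {0..b}" using x by auto
      have "cmod (D t) \<le> B * exp (2 * L * x)"
        using DB[OF tb] t B0 L(2) by (smt (verit) atLeastAtMost_iff exp_le_cancel_iff mult_left_mono)
      then show "cmod (g t) \<le> p t * (B * exp (2 * L * x)) + \<eta>"
        using g[OF tb] p(2)[OF tb] by (meson add_right_mono mult_left_mono order_trans)
    qed
    also have "\<dots> = integral {0..x} (\<lambda>t. p t * (B * exp (2 * L * x))) + integral {0..x} (\<lambda>t::real. \<eta>)"
      by (intro integral_add integrable_on_mult_left px) auto
    also have "\<dots> = integral {0..x} p * (B * exp (2 * L * x)) + \<eta> * x" using x by simp
    also have "\<dots> \<le> L * (B * exp (2 * L * x)) + \<eta> * b"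
    proof (intro add_mono mult_right_mono mult_left_mono)
      have "integral {0..x} p \<le> integral {0..b} p"
        using x p px by (intro integral_subset_le) auto
      then show "integral {0..x} p \<le> L" using L by simp
    qed (use x \<eta> B0 in auto)
    finally show ?thesis by (simp add: mult.assoc)
  qed
  have "B \<le> 2 * \<eta> * b\<^sup>2"
  proof (cases "x0 = 0")
    case True
    then show ?thesis using D0 \<eta> by (simp add: B_def)
  next
    case False
    then have x0': "0 < x0" "x0 \<le> b" using x0 by auto
    \<comment> \<open>Integrating L B exp(2 L x) produces the factor B/2. At the maximising point x0
      the left-hand side is B exp(2 L x0), so half of it is absorbed and only the contribution of
      \<eta> remains.\<close>
    have "cmod (D x0 - D 0) \<le> (B / 2 * exp (2 * L * x0) + \<eta> * b * x0) - (B / 2 * exp (2 * L * 0) + \<eta> * b * 0)"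
    proof (rule differentiable_bound_general[OF x0'(1)])
      show "continuous_on {0..x0} D" using Dc by (rule continuous_on_subset) (use x0' in auto)
      show "continuous_on {0..x0} (\<lambda>x. B / 2 * exp (2 * L * x) + \<eta> * b * x)" by (intro continuous_intros)
      fix x assume x: "0 < x" "x < x0"
      show "(D has_vector_derivative D' x) (at x)"
        using deriv[of x] x x0' at_within_Icc_at[of 0 x b] by auto
      show "((\<lambda>x. B / 2 * exp (2 * L * x) + \<eta> * b * x) has_vector_derivative L * B * exp (2 * L * x) + \<eta> * b) (at x)"
        by (auto intro!: derivative_eq_intros simp flip: has_real_derivative_iff_has_vector_derivative)
      show "cmod (D' x) \<le> L * B * exp (2 * L * x) + \<eta> * b" using x x0' by (intro D'B) auto
    qed
    also have "\<dots> \<le> B / 2 * exp (2 * L * x0) + \<eta> * b * b"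
      using B0 x0' \<eta> b by (intro diff_le_eq[THEN iffD2]) (simp add: mult_left_mono add_nonneg_nonneg add_increasing2)
    finally have "B * exp (2 * L * x0) \<le> 2 * \<eta> * b\<^sup>2" using D0 Dx0 by (simp add: power2_eq_square)
    moreover have "B * 1 \<le> B * exp (2 * L * x0)" using B0 L x0' by (intro mult_left_mono) auto
    ultimately show ?thesis by simp
  qed
  then have "B * exp (2 * L * b) \<le> 2 * \<eta> * b\<^sup>2 * exp (2 * L * b)" by (intro mult_right_mono) auto
  moreover have "cmod (D b) \<le> B * exp (2 * L * b)" using b by (intro DB) auto
  ultimately show ?thesis by (rule order_trans[rotated])
qed

text \<open>The difference of the solutions for \<rho> and 0 solves the equation for \<rho> with
  inhomogeneity -\<rho>^2 y_0 and zero initial data. Its value at pi is therefore of order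
  |\<rho>|^2.\<close>

lemma ivp_sol_tendsto_0:
  fixes Q :: "real \<Rightarrow> real"
  assumes Q: "set_integrable lborel {0..pi} Q"
    and sol: "\<And>\<rho>. ivp_sol Q (\<rho>\<^sup>2) 0 1 (y \<rho>)"
  shows "((\<lambda>\<rho>. y \<rho> pi) \<longlongrightarrow> y 0 pi) (at 0)"
proof -
  \<comment> \<open>Majorant of |Q - \<rho>^2|, uniform in |\<rho>| \<le> 1.\<close>
  define p where "p t = \<bar>Q t\<bar> + 1" for t
  have p: "p integrable_on {0..pi}"
  proof -
    have "set_integrable lborel {0..pi} (\<lambda>t. \<bar>Q t\<bar>)" using Q by (rule set_integrable_abs)
    from set_borel_integral_eq_integral(1)[OF this] show ?thesis
      unfolding p_def[abs_def] by (intro integrable_add) auto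
  qed
  define L where "L = max 1 (integral {0..pi} p)"
  have y0: "y \<rho> 0 = 0" for \<rho> using sol[of \<rho>] by (simp add: ivp_sol_def)
  have "\<forall>\<rho>. \<exists>d. \<forall>x\<in>{0..pi}. (y \<rho> has_vector_derivative d x) (at x within {0..pi}) \<and>
        (\<lambda>t. (complex_of_real (Q t) - \<rho>\<^sup>2) * y \<rho> t) integrable_on {0..x} \<and>
        d x = 1 + integral {0..x} (\<lambda>t. (complex_of_real (Q t) - \<rho>\<^sup>2) * y \<rho> t)"
  proof
    fix \<rho>
    from sol[of \<rho>, unfolded ivp_sol_def] show "\<exists>d. \<forall>x\<in>{0..pi}. (y \<rho> has_vector_derivative d x) (at x within {0..pi}) \<and>
        (\<lambda>t. (complex_of_real (Q t) - \<rho>\<^sup>2) * y \<rho> t) integrable_on {0..x} \<and>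
        d x = 1 + integral {0..x} (\<lambda>t. (complex_of_real (Q t) - \<rho>\<^sup>2) * y \<rho> t)" by blast
  qed
  from choice[OF this] obtain y' where "\<forall>\<rho>. \<forall>x\<in>{0..pi}. (y \<rho> has_vector_derivative y' \<rho> x) (at x within {0..pi}) \<and>
        (\<lambda>t. (complex_of_real (Q t) - \<rho>\<^sup>2) * y \<rho> t) integrable_on {0..x} \<and>
        y' \<rho> x = 1 + integral {0..x} (\<lambda>t. (complex_of_real (Q t) - \<rho>\<^sup>2) * y \<rho> t)" by (rule exE)
  then have der: "\<And>\<rho> x. x \<in> {0..pi} \<Longrightarrow> (y \<rho> has_vector_derivative y' \<rho> x) (at x within {0..pi})"
    and int: "\<And>\<rho> x. x \<in> {0..pi} \<Longrightarrow> (\<lambda>t. (complex_of_real (Q t) - \<rho>\<^sup>2) * y \<rho> t) integrable_on {0..x}"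
    and y': "\<And>\<rho> x. x \<in> {0..pi} \<Longrightarrow> y' \<rho> x = 1 + integral {0..x} (\<lambda>t. (complex_of_real (Q t) - \<rho>\<^sup>2) * y \<rho> t)"
    by blast+
  have "continuous_on {0..pi} (y 0)"
    using der by (meson continuous_on_eq_continuous_within has_vector_derivative_continuous)
  then have "compact (y 0 ` {0..pi})" by (intro compact_continuous_image) auto
  then obtain C where C: "\<And>t. t \<in> {0..pi} \<Longrightarrow> cmod (y 0 t) \<le> C"
    by (fastforce dest!: compact_imp_bounded simp: bounded_iff)
  have C0: "C \<ge> 0" using C[of 0] by (simp add: y0)
  define A where "A = 2 * C * pi\<^sup>2 * exp (2 * L * pi)"
  have bound: "cmod (y \<rho> pi - y 0 pi) \<le> A * (cmod \<rho>)\<^sup>2" if \<rho>: "cmod \<rho> \<le> 1" for \<rho>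
  proof -
    define g where "g t = (complex_of_real (Q t) - \<rho>\<^sup>2) * y \<rho> t - (complex_of_real (Q t) - 0\<^sup>2) * y 0 t" for t
    have "cmod (y \<rho> pi - y 0 pi) \<le> 2 * ((cmod \<rho>)\<^sup>2 * C) * pi\<^sup>2 * exp (2 * L * pi)"
    proof (rule volterra_bound[where D' = "\<lambda>x. y' \<rho> x - y' 0 x" and g = g and p = p])
      fix x assume x: "x \<in> {0..pi}"
      show "((\<lambda>x. y \<rho> x - y 0 x) has_vector_derivative y' \<rho> x - y' 0 x) (at x within {0..pi})"
        by (intro has_vector_derivative_diff der x)
      show "g integrable_on {0..x}" unfolding g_def[abs_def] by (intro integrable_diff int x)
      show "y' \<rho> x - y' 0 x = integral {0..x} g"
        unfolding g_def[abs_def] integral_diff[OF int[OF x] int[OF x]] y'[OF x] by simp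
      show "0 \<le> p x" by (simp add: p_def)
      have "g x = (complex_of_real (Q x) - \<rho>\<^sup>2) * (y \<rho> x - y 0 x) - \<rho>\<^sup>2 * y 0 x"
        by (simp add: g_def algebra_simps)
      then have "cmod (g x) \<le> cmod (complex_of_real (Q x) - \<rho>\<^sup>2) * cmod (y \<rho> x - y 0 x) + (cmod \<rho>)\<^sup>2 * cmod (y 0 x)"
        using norm_triangle_ineq4[of "(complex_of_real (Q x) - \<rho>\<^sup>2) * (y \<rho> x - y 0 x)" "\<rho>\<^sup>2 * y 0 x"]
        by (simp add: norm_mult norm_power)
      also have "\<dots> \<le> p x * cmod (y \<rho> x - y 0 x) + (cmod \<rho>)\<^sup>2 * C"
      proof (intro add_mono mult_right_mono mult_left_mono C x)
        have "cmod (complex_of_real (Q x) - \<rho>\<^sup>2) \<le> \<bar>Q x\<bar> + (cmod \<rho>)\<^sup>2"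
          using norm_triangle_ineq4[of "complex_of_real (Q x)" "\<rho>\<^sup>2"] by (simp add: norm_power)
        also have "\<dots> \<le> p x" using \<rho> by (simp add: p_def power_le_one)
        finally show "cmod (complex_of_real (Q x) - \<rho>\<^sup>2) \<le> p x" .
      qed auto
      finally show "cmod (g x) \<le> p x * cmod (y \<rho> x - y 0 x) + (cmod \<rho>)\<^sup>2 * C" .
    qed (use p C0 in \<open>auto simp: L_def y0\<close>)
    then show ?thesis by (simp add: A_def mult_ac)
  qed
  have "((\<lambda>\<rho>. A * (cmod \<rho>)\<^sup>2) \<longlongrightarrow> A * (cmod 0)\<^sup>2) (at 0)" by (intro tendsto_intros)
  then have "((\<lambda>\<rho>. A * (cmod \<rho>)\<^sup>2) \<longlongrightarrow> 0) (at 0)" by simp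
  moreover have "\<forall>\<^sub>F \<rho> in at 0. cmod (y \<rho> pi - y 0 pi) \<le> A * (cmod \<rho>)\<^sup>2"
    unfolding eventually_at by (intro exI[of _ 1]) (auto intro: bound)
  ultimately have "((\<lambda>\<rho>. y \<rho> pi - y 0 pi) \<longlongrightarrow> 0) (at 0)" by (rule Lim_null_comparison[rotated])
  then show ?thesis by (rule LIM_zero_cancel)
qed

section \<open>Zeros of the truncated series\<close>

lemma has_integral_scale_unit_interval:
  fixes f :: "real \<Rightarrow> 'a::real_normed_vector"
  assumes "(f has_integral I) {0..b}" "b > 0"
  shows "((\<lambda>u. b *\<^sub>R f (b * u)) has_integral I) {0..1}"
proof -
  have "((\<lambda>u. f (b *\<^sub>R u + 0)) has_integral (1 / \<bar>b\<bar> ^ DIM(real)) *\<^sub>R I) ((\<lambda>x. (1 / b) *\<^sub>R x + - ((1 / b) *\<^sub>R 0)) ` cbox 0 b)"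
    using assms by (intro has_integral_affinity) auto
  also have "(\<lambda>x. (1 / b) *\<^sub>R x + - ((1 / b) *\<^sub>R 0)) ` cbox 0 b = {0..1}"
    using assms(2) image_affinity_atLeastAtMost[of "1 / b" 0 0 b] by simp
  finally have "((\<lambda>u. f (b * u)) has_integral (1 / b) *\<^sub>R I) {0..1}" using assms(2) by simp
  from has_integral_cmul[OF this, of b] show ?thesis using assms(2) by simp
qed

lemma integral_scale_unit_interval:
  fixes f :: "real \<Rightarrow> 'a::banach"
  assumes "continuous_on {0..b} f" "b > 0"
  shows "integral {0..b} f = integral {0..1} (\<lambda>u. b *\<^sub>R f (b * u))"
  using has_integral_scale_unit_interval[OF integrable_integral[OF integrable_continuous_interval[OF assms(1)]] assms(2)]
  by (rule integral_unique[symmetric])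

text \<open>Away from 0 this is the Bessel integral summed over n. At 0 the weight u is P_1, so
  orthogonality keeps only n = 0 and its squared norm 1/3 gives the term s_0/3.\<close>

lemma S_trunc_eq_char_fun:
  "S_trunc s N = char_fun (\<lambda>u. \<Sum>n\<le>N. s n * legendreP (2 * n + 1) u)"
proof
  fix \<rho>
  have "sine_transform (\<lambda>u. \<Sum>n\<le>N. s n * legendreP (2 * n + 1) u) z
      = (\<Sum>n\<le>N. (-1) ^ n * of_real (s n) * sph_bessel_j (2 * n + 1) z)" for z
  proof -
    have "sine_transform (\<lambda>u. \<Sum>n\<le>N. s n * legendreP (2 * n + 1) u) z
      = integral {0..1} (\<lambda>u. \<Sum>n\<le>N. of_real (s n) * (of_real (legendreP (2 * n + 1) u) * sin (z * of_real u)))"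
      unfolding sine_transform_def by (simp only: of_real_sum of_real_mult sum_distrib_right mult.assoc)
    also have "\<dots> = (\<Sum>n\<le>N. integral {0..1} (\<lambda>u. of_real (s n) * (of_real (legendreP (2 * n + 1) u) * sin (z * of_real u))))"
      by (intro integral_sum integrable_continuous_interval continuous_intros) auto
    also have "\<dots> = (\<Sum>n\<le>N. of_real (s n) * ((-1) ^ n * sph_bessel_j (2 * n + 1) z))"
      by (simp only: integral_mult_right integral_legendreP_sin)
    finally show ?thesis by (simp only: mult_ac)
  qed
  moreover have "integral {0..1} (\<lambda>u. (\<Sum>n\<le>N. s n * legendreP (2 * n + 1) u) * u) = s 0 / 3"
  proof -
    have "integral {0..1} (\<lambda>u. (\<Sum>n\<le>N. s n * legendreP (2 * n + 1) u) * u)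
      = integral {0..1} (\<lambda>u. \<Sum>n\<le>N. s n * (legendreP (2 * n + 1) u * legendreP 1 u))"
      by (simp add: sum_distrib_right mult.assoc)
    also have "\<dots> = (\<Sum>n\<le>N. integral {0..1} (\<lambda>u. s n * (legendreP (2 * n + 1) u * legendreP 1 u)))"
      by (intro integral_sum integrable_continuous_interval continuous_intros) auto
    also have "\<dots> = (\<Sum>n\<le>N. if n = 0 then s 0 / 3 else 0)"
    proof (intro sum.cong refl)
      fix n
      show "integral {0..1} (\<lambda>u. s n * (legendreP (2 * n + 1) u * legendreP 1 u)) = (if n = 0 then s 0 / 3 else 0)"
        using legendreP_orthogonal[of "2 * n + 1" 1] legendreP_norm[of 1] by (simp del: legendreP.simps)
    qed
    finally show ?thesis by simp
  qed
  ultimately show "S_trunc s N \<rho> = char_fun (\<lambda>u. \<Sum>n\<le>N. s n * legendreP (2 * n + 1) u) \<rho>"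
    unfolding S_trunc_def char_fun_def
    by (simp only: add_divide_distrib mult.commute[of \<rho>] times_divide_eq_left times_divide_eq_right mult_1)
qed

text \<open>\<open>K\<close> is the transmutation kernel at x = pi, and \<open>s\<close> lists its
  Fourier-Legendre coefficients. The bijection respects multiplicities; its surjectivity expresses
  that the truncated function has no other zeros.\<close>

theorem theorem2:
  fixes q :: "real \<Rightarrow> real" and mu1sq :: real
    and St :: "complex \<Rightarrow> real \<Rightarrow> complex"
    and K :: "real \<Rightarrow> real" and s :: "nat \<Rightarrow> real"
  assumes q_meas: "set_borel_measurable lborel {0..pi} q"
    and q_L2: "set_integrable lborel {0..pi} (\<lambda>x. (q x)^2)"
    and mu_eig: "dirichlet_eigenvalue q mu1sq"
    and mu_min: "\<forall>lam. dirichlet_eigenvalue q lam \<longrightarrow> mu1sq \<le> lam"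
    and St_sol: "\<forall>\<rho>. ivp_sol (\<lambda>x. q x - mu1sq) (\<rho>^2) 0 1 (St \<rho>)"
    and K_cont: "continuous_on {0..pi} K"
    and K_repr: "\<forall>\<rho>. \<rho> \<noteq> 0 \<longrightarrow> St \<rho> pi = sin (\<rho> * pi) / \<rho>
                   + integral {0..pi} (\<lambda>t. of_real (K t) * sin (\<rho> * of_real t) / \<rho>)"
    and s_def: "\<forall>n. s n = (4 * real n + 3) * integral {0..pi} (\<lambda>t. K t * legendreP (2*n+1) (t / pi))"
  shows "\<forall>\<epsilon>>0. \<exists>N::nat. \<exists>\<phi>.
           bij_betw \<phi> (zeros_mult (\<lambda>\<rho>. St \<rho> pi)) (zeros_mult (S_trunc s N)) \<and>
           (\<forall>p \<in> zeros_mult (\<lambda>\<rho>. St \<rho> pi). cmod (fst p - fst (\<phi> p)) \<le> \<epsilon>)"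
proof (intro allI impI)
  fix \<epsilon> :: real assume \<epsilon>: "\<epsilon> > 0"
  \<comment> \<open>The factor pi is the Jacobian of t = pi u; with it the coefficient formula keeps
    its form on [0,1].\<close>
  define k where "k u = pi * K (pi * u)" for u
  have k: "continuous_on {0..1} k"
    unfolding k_def by (intro continuous_intros continuous_on_compose2[OF K_cont]) auto
  have St_nonzero: "St \<rho> pi = char_fun k \<rho>" if \<rho>: "\<rho> \<noteq> 0" for \<rho>
  proof -
    have "integral {0..pi} (\<lambda>t. of_real (K t) * sin (\<rho> * of_real t) / \<rho>)
      = integral {0..1} (\<lambda>u. pi *\<^sub>R (of_real (K (pi * u)) * sin (\<rho> * of_real (pi * u)) / \<rho>))"
      by (rule integral_scale_unit_interval) (use \<rho> in \<open>auto intro!: continuous_intros K_cont\<close>)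
    also have "\<dots> = integral {0..1} (\<lambda>u. of_real (k u) * sin (of_real pi * \<rho> * of_real u) / \<rho>)"
      by (simp add: k_def scaleR_conv_of_real mult_ac)
    also have "\<dots> = sine_transform k (of_real pi * \<rho>) / \<rho>"
      by (simp add: sine_transform_def)
    finally show ?thesis using K_repr \<rho> by (simp add: char_fun_def add_divide_distrib mult.commute)
  qed
  \<comment> \<open>Square integrability passes to integrability on the bounded interval through |q|
    \<le> 1 + q^2; integrability is what the continuity argument at \<rho> = 0 consumes.\<close>
  have q: "set_integrable lborel {0..pi} q"
  proof (rule set_integrable_bound)
    show "set_integrable lborel {0..pi} (\<lambda>x. 1 + (q x)\<^sup>2)"
      by (intro set_integral_add q_L2) (simp add: set_integrable_def)
    have "\<bar>q x\<bar> \<le> 1 + (q x)\<^sup>2" for x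
      using zero_le_power2[of "\<bar>q x\<bar> - 1"] by (simp add: power2_eq_square algebra_simps)
    then show "AE x in lborel. x \<in> {0..pi} \<longrightarrow> norm (q x) \<le> norm (1 + (q x)\<^sup>2)"
      by (intro AE_I2) (auto intro: order_trans)
  qed (rule q_meas)
  have "St 0 pi = char_fun k 0"
  proof (rule tendsto_unique[OF at_neq_bot])
    show "((\<lambda>\<rho>. St \<rho> pi) \<longlongrightarrow> St 0 pi) (at 0)"
    proof (rule ivp_sol_tendsto_0)
      show "set_integrable lborel {0..pi} (\<lambda>x. q x - mu1sq)"
        by (intro set_integral_diff q) (simp add: set_integrable_def)
    qed (use St_sol in auto)
    have "isCont (char_fun k) 0"
      using holomorphic_on_imp_continuous_on[OF char_fun_holomorphic[OF k]] by (simp add: continuous_on_eq_continuous_at)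
    then have "(char_fun k \<longlongrightarrow> char_fun k 0) (at 0)" by (simp add: isCont_def)
    then show "((\<lambda>\<rho>. St \<rho> pi) \<longlongrightarrow> char_fun k 0) (at 0)"
      by (rule Lim_transform_eventually) (auto simp: eventually_at_filter St_nonzero)
  qed
  then have "St \<rho> pi = char_fun k \<rho>" for \<rho> by (cases "\<rho> = 0") (simp_all add: St_nonzero)
  then have St: "(\<lambda>\<rho>. St \<rho> pi) = char_fun k" by (rule ext)
  have s: "s n = (4 * real n + 3) * integral {0..1} (\<lambda>u. k u * legendreP (2 * n + 1) u)" for n
  proof -
    have "integral {0..pi} (\<lambda>t. K t * legendreP (2 * n + 1) (t / pi))
        = integral {0..1} (\<lambda>u. pi *\<^sub>R (K (pi * u) * legendreP (2 * n + 1) (pi * u / pi)))"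
      by (rule integral_scale_unit_interval) (auto intro!: continuous_intros K_cont)
    then show ?thesis using s_def by (simp add: k_def mult.assoc)
  qed
  from char_fun_zeros_stable[OF k \<epsilon>] obtain \<delta> where \<delta>: "\<delta> > 0"
    and stable: "\<forall>l. continuous_on {0..1} l \<longrightarrow> integral {0..1} (\<lambda>u. \<bar>k u - l u\<bar>) \<le> \<delta> \<longrightarrow>
       (\<exists>\<phi>. bij_betw \<phi> (zeros_mult (char_fun k)) (zeros_mult (char_fun l)) \<and>
         (\<forall>p \<in> zeros_mult (char_fun k). cmod (fst p - fst (\<phi> p)) \<le> \<epsilon>))"
    by (elim exE conjE)
  obtain N where N: "integral {0..1} (\<lambda>u. \<bar>k u - (\<Sum>n\<le>N. s n * legendreP (2 * n + 1) u)\<bar>) \<le> \<delta>"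
    using odd_legendre_partial_sums_L1[OF k s \<delta>] by blast
  have "continuous_on {0..1} (\<lambda>u. \<Sum>n\<le>N. s n * legendreP (2 * n + 1) u)" by (intro continuous_intros)
  from stable[THEN spec, THEN mp, THEN mp, OF this N]
  show "\<exists>N::nat. \<exists>\<phi>.
           bij_betw \<phi> (zeros_mult (\<lambda>\<rho>. St \<rho> pi)) (zeros_mult (S_trunc s N)) \<and>
           (\<forall>p \<in> zeros_mult (\<lambda>\<rho>. St \<rho> pi). cmod (fst p - fst (\<phi> p)) \<le> \<epsilon>)"
    unfolding St S_trunc_eq_char_fun by (rule exI)
qed

end
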